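(* Let $\Xi_k^{\omega}\in\mathbb{S}^m$, $\xi^{\omega}\in\mathbb{R}$ ($\omega\in\Omega^o$, $k=1,\ldots,\kappa$) be symmetric matrices and scalars not depending on the signaling rule such that, for every $\eta\in\Upsilon$ and every choice of best responses, $U_S(\eta,\{\gamma^{\omega}(\eta)\})=\max_{p\in\Delta(\Omega^o)}\sum_{\omega\in\Omega^o}p_{\omega}\big(\xi^{\omega}+\sum_{k=1}^{\kappa}\mathrm{Tr}\{H_k(\eta)\Xi_k^{\omega}\}\big)$. Let $\Psi$ be the set of tuples $S=(S_1,\ldots,S_\kappa)$, $S_k\in\mathbb{S}^m_+$, with $\Sigma_1^o\succeq S_1\succeq O$ and $\Sigma_k^o\succeq S_k\succeq AS_{k-1}A'$ for $k>1$. For $\omega\in\Omega^o$ define $$\mu_{\omega}:=\min_{S\in\Psi}\Big[\xi^{\omega}+\sum_{k=1}^{\kappa}\mathrm{Tr}\{\Xi_k^{\omega}S_k\}\Big]\ \text{ s.t. }\ \sum_{k=1}^{\kappa}\mathrm{Tr}\{S_k(\Xi_k^{\omega}-\Xi_k^{\omega'})\}\ge\xi^{\omega'}-\xi^{\omega}\ \ \forall\omega'\in\Omega^o.$$ Then the value $\min_{S\in\Psi}\max_{p\in\Delta(\Omega^o)}\sum_{\omega\in\Omega^o}p_{\omega}\big(\xi^{\omega}+\sum_k\mathrm{Tr}\{S_k\Xi_k^{\omega}\}\big)$ of the Stackelberg equilibrium equals $\mu:=\min_{\omega\in\Omega^o}\mu_{\omega}$. Furthermore, if $\omega^*\in\Omega^o$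 satisfies $\mu_{\omega^*}=\mu$ and $S^*$ is a minimizer of the problem defining $\mu_{\omega^*}$, then there exists a linear-plus-noise signaling rule $\eta\in\Upsilon$ with $H_k(\eta)=S^*_k$ for all $k$, and such an $\eta$ is an equilibrium (minimizing) signaling rule for the sensor.
   Context: Setting (perfect measurements): $\mathbf{x}_{k+1}=A\mathbf{x}_k+B\mathbf{u}_k+\mathbf{w}_k$, $k=1,\ldots,\kappa$, $A\in\mathbb{R}^{m\times m}$, $B\in\mathbb{R}^{m\times r}$, $\mathbf{x}_1\sim\mathcal{N}(0,\Sigma_1)$, $\mathbf{w}_k\sim\mathcal{N}(0,\Sigma_w)$ i.i.d. independent of $\mathbf{x}_1$. Signaling rules $\eta\in\Upsilon$: $\mathbf{s}_k=L_k'\mathbf{x}_{1:k}+\boldsymbol{\vartheta}_k\in\mathbb{R}^m$, $\mathbf{x}_{1:k}=[\mathbf{x}_k'\cdots\mathbf{x}_1']'$, $L_k\in\mathbb{R}^{mk\times m}$ arbitrary, $\boldsymbol{\vartheta}_k\sim\mathcal{N}(0,\Theta_k)$, $\Theta_k\in\mathbb{S}^m_+$ arbitrary, independent of everything else. Control policies $\gamma\in\Gamma$: $\mathbf{u}_k=\gamma_k(\mathbf{s}_{1:k})$, $\gamma_k$ Borel. Finite type set $\Omega$, $\Omega^o=\Omega\cup\{\omega_o\}$, weights $Q^{\omega}\in\mathbb{S}^m_+$, $R^{\omega}\in\mathbb{S}^r_{++}$. Type-$\omega$ cost $U_C^{\omega}(\eta,\gamma)=\sum_{k=1}^{\kappa}\mathbb{E}\|\mathbf{x}^{\omega}_{k+1}\|^2_{Q^{\omega}}+\mathbb{E}\|\mathbf{u}^{\omega}_k\|^2_{R^{\omega}}$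 ($\|z\|_M^2=z'Mz$); best response $\gamma^{\omega}(\eta)\in\arg\min_{\gamma\in\Gamma}U_C^{\omega}(\eta,\gamma)$. Leader cost $U_S(\eta,\{\gamma^{\omega}\})=\max_{p\in\Delta(\Omega^o)}\{\sum_{\omega\in\Omega}p_{\omega}\sum_k\mathbb{E}\|\mathbf{x}^{\omega}_{k+1}\|^2_{Q^{\omega_o}}+p_{\omega_o}\sum_k(\mathbb{E}\|\mathbf{x}^{\omega_o}_{k+1}\|^2_{Q^{\omega_o}}+\mathbb{E}\|\mathbf{u}^{\omega_o}_k\|^2_{R^{\omega_o}})\}$, $\Delta(\Omega^o)$ the probability simplex. Control-free state $\mathbf{x}^o_{k+1}=A\mathbf{x}^o_k+\mathbf{w}_k$, $\mathbf{x}^o_1=\mathbf{x}_1$; $\Sigma_k^o=\mathbb{E}\{\mathbf{x}^o_k(\mathbf{x}^o_k)'\}$; $H_k(\eta)=\mathrm{cov}\{\mathbb{E}\{\mathbf{x}^o_k\mid\mathbf{s}_{1:k}\}\}$ (depends only on $\eta$). A minimum over an empty feasible set is $+\infty$. *)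

theory Defs
  imports "HOL-Analysis.Analysis" "HOL-Probability.Probability"
begin

type_synonym ('m) mat = "real^'m^'m"

definition symm :: "real^'m^'m \<Rightarrow> bool" where
  "symm S \<longleftrightarrow> transpose S = S"

definition psd :: "real^'m^'m \<Rightarrow> bool" where
  "psd S \<longleftrightarrow> symm S \<and> (\<forall>x. 0 \<le> x \<bullet> (S *v x))"

definition loewner_ge :: "real^'m^'m \<Rightarrow> real^'m^'m \<Rightarrow> bool" where
  "loewner_ge S T \<longleftrightarrow> psd (S - T)"

definition prob_simplex :: "'a set \<Rightarrow> ('a \<Rightarrow> real) set" where
  "prob_simplex W = {p. (\<forall>w\<in>W. 0 \<le> p w) \<and> (\<Sum>w\<in>W. p w) = 1}"

definition vexp :: "'w measure \<Rightarrow> ('w \<Rightarrow> real^'m) \<Rightarrow> real^'m" where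
  "vexp M X = (\<chi> i. integral\<^sup>L M (\<lambda>\<omega>. X \<omega> $ i))"

definition smom :: "'w measure \<Rightarrow> ('w \<Rightarrow> real^'m) \<Rightarrow> real^'m^'m" where
  "smom M X = (\<chi> i j. integral\<^sup>L M (\<lambda>\<omega>. X \<omega> $ i * X \<omega> $ j))"

definition cov :: "'w measure \<Rightarrow> ('w \<Rightarrow> real^'m) \<Rightarrow> real^'m^'m" where
  "cov M X = smom M (\<lambda>\<omega>. X \<omega> - vexp M X)"

text \<open>Zero-mean Gaussian random vector with covariance Sig (Cramer-Wold: every
  linear functional a'X is N(0, a' Sig a), a degenerate normal being the point mass at 0).\<close>
definition gaussian_vec :: "'w measure \<Rightarrow> ('w \<Rightarrow> real^'m) \<Rightarrow> real^'m^'m \<Rightarrow> bool" where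
  "gaussian_vec M X Sig \<longleftrightarrow> X \<in> borel_measurable M \<and>
     (\<forall>a. distr M borel (\<lambda>\<omega>. a \<bullet> X \<omega>) =
        (if a \<bullet> (Sig *v a) = 0 then return borel 0
         else density lborel (normal_density 0 (sqrt (a \<bullet> (Sig *v a))))))"

definition gen_sa :: "'w measure \<Rightarrow> ('w \<Rightarrow> real^'m) set \<Rightarrow> 'w measure" where
  "gen_sa M Xs = sigma (space M) {X -` B \<inter> space M | X B. X \<in> Xs \<and> B \<in> sets borel}"

definition vcond_exp :: "'w measure \<Rightarrow> 'w measure \<Rightarrow> ('w \<Rightarrow> real^'m) \<Rightarrow> 'w \<Rightarrow> real^'m" where
  "vcond_exp M F X = (\<lambda>\<omega>. \<chi> i. real_cond_exp M F (\<lambda>\<nu>. X \<nu> $ i) \<omega>)"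

text \<open>Control-free state: xo 1 = x_1, xo (k+1) = A xo k + w_k (index 0 unused).\<close>
fun xo :: "real^'m^'m \<Rightarrow> ('w \<Rightarrow> real^'m) \<Rightarrow> (nat \<Rightarrow> 'w \<Rightarrow> real^'m) \<Rightarrow> nat \<Rightarrow> 'w \<Rightarrow> real^'m" where
  "xo A x1 w 0 = x1"
| "xo A x1 w (Suc 0) = x1"
| "xo A x1 w (Suc (Suc k)) = (\<lambda>\<omega>. A *v xo A x1 w (Suc k) \<omega> + w (Suc k) \<omega>)"

definition Sigo :: "'w measure \<Rightarrow> real^'m^'m \<Rightarrow> ('w \<Rightarrow> real^'m) \<Rightarrow> (nat \<Rightarrow> 'w \<Rightarrow> real^'m) \<Rightarrow> nat \<Rightarrow> real^'m^'m" where
  "Sigo M A x1 w k = smom M (xo A x1 w k)"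

text \<open>Primitive random vectors: x_1, w_1..w_kappa, and (for a signaling rule) noises
  theta_1..theta_kappa, packaged as one family for stating mutual independence.\<close>
definition prim :: "('w \<Rightarrow> real^'m) \<Rightarrow> (nat \<Rightarrow> 'w \<Rightarrow> real^'m) \<Rightarrow> (nat \<Rightarrow> 'w \<Rightarrow> real^'m)
    \<Rightarrow> (nat + nat) option \<Rightarrow> 'w \<Rightarrow> real^'m" where
  "prim x1 w th i = (case i of None \<Rightarrow> x1 | Some (Inl k) \<Rightarrow> w k | Some (Inr k) \<Rightarrow> th k)"

definition prim_idx :: "nat \<Rightarrow> (nat + nat) option set" where
  "prim_idx \<kappa> = {None} \<union> Some ` Inl ` {1..\<kappa>} \<union> Some ` Inr ` {1..\<kappa>}"

definition noise_ok :: "'w measure \<Rightarrow> nat \<Rightarrow> ('w \<Rightarrow> real^'m) \<Rightarrow> (nat \<Rightarrow> 'w \<Rightarrow> real^'m)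
    \<Rightarrow> (nat \<Rightarrow> 'w \<Rightarrow> real^'m) \<Rightarrow> (nat \<Rightarrow> real^'m^'m) \<Rightarrow> bool" where
  "noise_ok M \<kappa> x1 w th Th \<longleftrightarrow>
     (\<forall>k\<in>{1..\<kappa>}. psd (Th k) \<and> gaussian_vec M (th k) (Th k)) \<and>
     prob_space.indep_vars M (\<lambda>_. borel) (prim x1 w th) (prim_idx \<kappa>)"

text \<open>A signaling rule eta = (L, theta): s_k = L_k' x_{1:k} + theta_k, where the block
  of L_k acting on x_j is written L k j (an arbitrary m x m matrix), i.e.
  s_k = sum_{j=1..k} L k j *v x_j + theta_k.  Upsilon: all such rules with admissible noise.\<close>
definition Upsilon :: "'w measure \<Rightarrow> nat \<Rightarrow> ('w \<Rightarrow> real^'m) \<Rightarrow> (nat \<Rightarrow> 'w \<Rightarrow> real^'m)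
    \<Rightarrow> ((nat \<Rightarrow> nat \<Rightarrow> real^'m^'m) \<times> (nat \<Rightarrow> 'w \<Rightarrow> real^'m)) set" where
  "Upsilon M \<kappa> x1 w = {(L, th). \<exists>Th. noise_ok M \<kappa> x1 w th Th}"

text \<open>Signal s_k along the control-free trajectory (zero control policy, so x = xo).\<close>
definition sig :: "real^'m^'m \<Rightarrow> ('w \<Rightarrow> real^'m) \<Rightarrow> (nat \<Rightarrow> 'w \<Rightarrow> real^'m)
    \<Rightarrow> (nat \<Rightarrow> nat \<Rightarrow> real^'m^'m) \<times> (nat \<Rightarrow> 'w \<Rightarrow> real^'m) \<Rightarrow> nat \<Rightarrow> 'w \<Rightarrow> real^'m" where
  "sig A x1 w eta k = (\<lambda>\<omega>. (\<Sum>j=1..k. fst eta k j *v xo A x1 w j \<omega>) + snd eta k \<omega>)"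

definition Hk :: "'w measure \<Rightarrow> real^'m^'m \<Rightarrow> ('w \<Rightarrow> real^'m) \<Rightarrow> (nat \<Rightarrow> 'w \<Rightarrow> real^'m)
    \<Rightarrow> (nat \<Rightarrow> nat \<Rightarrow> real^'m^'m) \<times> (nat \<Rightarrow> 'w \<Rightarrow> real^'m) \<Rightarrow> nat \<Rightarrow> real^'m^'m" where
  "Hk M A x1 w eta k =
     cov M (vcond_exp M (gen_sa M (sig A x1 w eta ` {1..k})) (xo A x1 w k))"

definition Psi :: "nat \<Rightarrow> real^'m^'m \<Rightarrow> (nat \<Rightarrow> real^'m^'m) \<Rightarrow> (nat \<Rightarrow> real^'m^'m) set" where
  "Psi \<kappa> A So = {S. (\<forall>k\<in>{1..\<kappa>}. psd (S k)) \<and>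
      loewner_ge (So 1) (S 1) \<and> loewner_ge (S 1) 0 \<and>
      (\<forall>k\<in>{2..\<kappa>}. loewner_ge (So k) (S k) \<and> loewner_ge (S k) (A ** S (k - 1) ** transpose A))}"

definition game_obj :: "'a set \<Rightarrow> nat \<Rightarrow> ('a \<Rightarrow> real) \<Rightarrow> (nat \<Rightarrow> 'a \<Rightarrow> real^'m^'m)
    \<Rightarrow> (nat \<Rightarrow> real^'m^'m) \<Rightarrow> real" where
  "game_obj W \<kappa> xi Xi S =
     (SUP p\<in>prob_simplex W. \<Sum>w\<in>W. p w * (xi w + (\<Sum>k=1..\<kappa>. trace (S k ** Xi k w))))"

text \<open>mu_omega (min over an empty feasible set is +infinity; Inf {} = top in ereal)\<close>
definition mu_w :: "'a set \<Rightarrow> nat \<Rightarrow> real^'m^'m \<Rightarrow> (nat \<Rightarrow> real^'m^'m) \<Rightarrow> ('a \<Rightarrow> real)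
    \<Rightarrow> (nat \<Rightarrow> 'a \<Rightarrow> real^'m^'m) \<Rightarrow> 'a \<Rightarrow> ereal" where
  "mu_w W \<kappa> A So xi Xi w =
     (INF S\<in>{S\<in>Psi \<kappa> A So. \<forall>w'\<in>W.
              (\<Sum>k=1..\<kappa>. trace (S k ** (Xi k w - Xi k w'))) \<ge> xi w' - xi w}.
        ereal (xi w + (\<Sum>k=1..\<kappa>. trace (Xi k w ** S k))))"

end

theory Submission
  imports Defs
begin

text \<open>Over the simplex a maximum of a linear function is attained at a vertex, so \<open>\<Psi>\<close> is covered by
  the feasible sets of the problems defining the \<open>\<mu>\<^sub>\<omega>\<close>, and \<open>\<Psi>\<close> is compact up to irrelevant coordinates.
  The probabilistic content is that the tuples \<open>H(\<eta>)\<close> are exactly the elements of \<open>\<Psi>\<close>.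
  They lie in \<open>\<Psi>\<close> because conditioning contracts second moments and
  \<open>E[x\<^sub>k\<^sub>+\<^sub>1 | s\<^sub>1\<^sub>:\<^sub>k] = A E[x\<^sub>k | s\<^sub>1\<^sub>:\<^sub>k]\<close>.
  Conversely, for \<open>S \<in> \<Psi>\<close> put \<open>P\<^sub>k = \<Sigma>\<^sub>k - A S\<^sub>k\<^sub>-\<^sub>1 A'\<close> and \<open>D\<^sub>k = S\<^sub>k - A S\<^sub>k\<^sub>-\<^sub>1 A'\<close>,
  so that \<open>O \<preceq> D\<^sub>k \<preceq> P\<^sub>k\<close>, choose \<open>G\<^sub>k\<close> with \<open>G\<^sub>k P\<^sub>k = D\<^sub>k\<close>, and send
  \<open>s\<^sub>k = G\<^sub>k x\<^sub>k + \<theta>\<^sub>k\<close> with noise covariance \<open>D\<^sub>k - D\<^sub>k G\<^sub>k'\<close>. Then the recursive estimate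
  (\<open>A\<close> times the previous estimate, plus the innovation) has covariance \<open>S\<^sub>k\<close>, and its error is uncorrelated with the signals,
  hence independent of them by joint Gaussianity.\<close>

section \<open>Positive semidefinite matrices\<close>

text \<open>Three obstacles shape the proof. \<open>gaussian_vec\<close> fixes only the laws of
  one-dimensional projections, so the independence of an uncorrelated error from all signals has to
  be extracted from a factorizing characteristic function, one scalar coordinate at a time. P_k may
  be singular (after full disclosure it is the noise covariance, which is only semidefinite), so G_k
  comes from a generalized inverse; this works because D_k vanishes on the kernel of P_k. Finally,
  the signal contains G_k x_k and not G_k times the innovation; the two differ by a linear function
  of the previous estimate, which the receiver already knows, so the filter can be computed with the
  innovation instead.\<close>

lemma inner_matrix_vector_symm:
  assumes "symm S"
  shows "x \<bullet> (S *v y) = (S *v x) \<bullet> y"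
  using assms dot_lmul_matrix[of x S y] transpose_matrix_vector[of S x] by (simp add: symm_def)

lemma psd_add: "psd S \<Longrightarrow> psd T \<Longrightarrow> psd (S + T)"
  by (simp add: psd_def symm_def transpose_def vec_eq_iff matrix_vector_mult_add_rdistrib inner_add_right)

lemma psd_zero: "psd 0"
  by (simp add: psd_def symm_def transpose_def vec_eq_iff)

text \<open>Moving from \<open>x\<close> slightly against \<open>y = D x\<close> changes the form at
  first order by \<open>2 t |y|^2\<close>, which would make it negative unless
  \<open>y = 0\<close>.\<close>

lemma psd_kernel:
  assumes D: "psd D" and 0: "x \<bullet> (D *v x) = 0"
  shows "D *v x = 0"
proof (rule ccontr)
  define y where "y = D *v x"
  define c where "c = y \<bullet> (D *v y)"
  assume "D *v x \<noteq> 0"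
  then have y: "y \<bullet> y > 0" by (simp add: y_def)
  have c: "c \<ge> 0" using D by (simp add: psd_def c_def)
  have xy: "x \<bullet> (D *v y) = y \<bullet> y"
    using D inner_matrix_vector_symm[of D x y] by (simp add: psd_def y_def)
  have quad: "(x + t *\<^sub>R y) \<bullet> (D *v (x + t *\<^sub>R y)) = t * (2 * (y \<bullet> y) + t * c)" for t
    using 0 xy unfolding c_def
    by (simp add: inner_add_left inner_add_right matrix_vector_right_distrib matrix_vector_mult_scaleR
        y_def[symmetric] algebra_simps)
  \<comment> \<open>This choice keeps \<open>t * c\<close> above \<open>- (y \<bullet> y)\<close>;
    the \<open>+ 1\<close> keeps the denominator positive when \<open>c = 0\<close>.\<close>
  define t where "t = - (y \<bullet> y) / (c + 1)"
  have t: "t < 0" using y c by (simp add: t_def divide_neg_pos)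
  have "t * c \<ge> - (y \<bullet> y)"
    using y c by (simp add: t_def field_simps)
  then have "2 * (y \<bullet> y) + t * c > 0" using y by linarith
  with t have "t * (2 * (y \<bullet> y) + t * c) < 0" by (rule mult_neg_pos)
  moreover have "0 \<le> (x + t *\<^sub>R y) \<bullet> (D *v (x + t *\<^sub>R y))"
    using D unfolding psd_def by blast
  ultimately show False using quad[of t] by linarith
qed

text \<open>Writing \<open>G = D P\<^sup>+\<close>, the second claim is the Schur complement condition
  \<open>D - D P\<^sup>+ D \<succeq> O\<close>.\<close>
lemma gain_matrix_exists:
  assumes D: "psd D" and PD: "psd (P - D)"
  shows "\<exists>G. G ** P = D \<and> psd (D - D ** transpose G)"
proof -
  have P: "psd P" using psd_add[OF D PD] by simp
  \<comment> \<open>On the kernel of \<open>P\<close> the form of \<open>D\<close> is squeezed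
    between 0 and that of \<open>P\<close>.\<close>
  have ker: "D *v x = 0" if "P *v x = 0" for x
  proof (rule psd_kernel[OF D])
    have "0 \<le> x \<bullet> ((P - D) *v x)" "0 \<le> x \<bullet> (D *v x)"
      using PD D unfolding psd_def by blast+
    then show "x \<bullet> (D *v x) = 0"
      using that by (simp add: matrix_vector_mult_diff_rdistrib)
  qed
  \<comment> \<open>A linear generalized inverse: \<open>g (P x)\<close> recovers \<open>x\<close>
    up to the kernel of \<open>P\<close>, which \<open>D\<close> annihilates.\<close>
  obtain g where g: "linear g" "\<And>x. P *v g (P *v x) = P *v x"
    using linear_exists_right_inverse_on[of "(*v) P" UNIV] by auto
  define G where "G = D ** matrix g"
  have "(G ** P) *v x = D *v x" for x
  proof -
    have "P *v (g (P *v x) - x) = 0"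
      using g(2) by (simp add: matrix_vector_mult_diff_distrib)
    then have "D *v (g (P *v x) - x) = 0" by (rule ker)
    then show ?thesis
      using g(1) by (simp add: G_def matrix_vector_mul_assoc[symmetric] matrix_works
          matrix_vector_mult_diff_distrib linear_matrix_vector_mul_eq)
  qed
  then have GP: "G ** P = D" by (simp add: matrix_eq)
  have PG: "P ** transpose G = D"
    using arg_cong[OF GP, of transpose] P D by (simp add: matrix_transpose_mul psd_def symm_def)
  have "symm (D - D ** transpose G)"
  proof -
    have "transpose (D ** transpose G) = G ** D"
      using D by (simp add: matrix_transpose_mul psd_def symm_def)
    also have "\<dots> = D ** transpose G"
      by (metis GP PG matrix_mul_assoc)
    finally show ?thesis
      using D by (simp add: symm_def psd_def transpose_def vec_eq_iff)
  qed
  moreover have "0 \<le> a \<bullet> ((D - D ** transpose G) *v a)" for a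
  proof -
    \<comment> \<open>Since \<open>P b = D a\<close>, the forms of \<open>P - D\<close> at
      \<open>b\<close> and of \<open>D\<close> at \<open>a - b\<close> add up to
      \<open>a D a - a D b\<close>, the form to be bounded.\<close>
    define b where "b = transpose G *v a"
    have Pb: "P *v b = D *v a" using PG by (simp only: b_def matrix_vector_mul_assoc)
    have "0 \<le> b \<bullet> ((P - D) *v b)" "0 \<le> (a - b) \<bullet> (D *v (a - b))"
      using PD D unfolding psd_def by blast+
    moreover have "a \<bullet> (D *v b) = b \<bullet> (D *v a)"
      using inner_matrix_vector_symm[of D a b] D by (simp add: psd_def inner_commute)
    ultimately have "0 \<le> a \<bullet> (D *v a) - a \<bullet> (D *v b)"
      by (simp add: Pb matrix_vector_mult_diff_rdistrib matrix_vector_mult_diff_distrib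
          inner_diff_left inner_diff_right)
    then show ?thesis
      by (simp only: b_def matrix_vector_mult_diff_rdistrib inner_diff_right matrix_vector_mul_assoc)
  qed
  ultimately show ?thesis using GP by (auto simp: psd_def)
qed

lemma quadratic_form_entries: "x \<bullet> (S *v x) = (\<Sum>i\<in>UNIV. \<Sum>j\<in>UNIV. x $ i * (S $ i $ j * x $ j))"
  for S :: "real^'m::finite^'m"
  by (simp add: inner_vec_def matrix_vector_mult_def sum_distrib_left)

text \<open>Test vectors for recovering entries from the form: \<open>c = 0\<close> isolates a
  diagonal entry, \<open>c = 1\<close> and \<open>c = -1\<close> control the off-diagonal
  ones.\<close>

lemma quadratic_form_axis:
  fixes S :: "real^'m::finite^'m"
  shows "(axis i 1 + c *\<^sub>R axis j 1) \<bullet> (S *v (axis i 1 + c *\<^sub>R axis j 1))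
    = S $ i $ i + c * S $ i $ j + c * S $ j $ i + c\<^sup>2 * S $ j $ j"
  by (simp add: matrix_vector_right_distrib matrix_vector_mult_scaleR matrix_vector_mult_basis
      inner_add_left inner_axis' column_def power2_eq_square algebra_simps)

lemma psd_entry_bound:
  fixes S T :: "real^'m::finite^'m"
  assumes S: "psd S" and TS: "psd (T - S)"
  shows "\<bar>S $ i $ j\<bar> \<le> T $ i $ i + T $ j $ j"
proof -
  have q: "0 \<le> (axis i 1 + c *\<^sub>R axis j 1) \<bullet> (S *v (axis i 1 + c *\<^sub>R axis j 1))" for c i j
    using S unfolding psd_def by blast
  have q': "0 \<le> (axis i 1 + 0 *\<^sub>R axis i 1) \<bullet> ((T - S) *v (axis i 1 + 0 *\<^sub>R axis i 1))" for i
    using TS unfolding psd_def by blast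
  have sym: "S $ j $ i = S $ i $ j"
    using S unfolding psd_def symm_def by (metis transpose_def vec_lambda_beta)
  have "S $ i $ i \<le> T $ i $ i" "S $ j $ j \<le> T $ j $ j"
    using q'[of i] q'[of j] unfolding quadratic_form_axis by simp_all
  moreover have "0 \<le> S $ i $ i" "0 \<le> S $ j $ j"
    using q[of i 0 i] q[of j 0 j] unfolding quadratic_form_axis by simp_all
  ultimately show ?thesis
    using q[of i 1 j] q[of i "-1" j] sym unfolding quadratic_form_axis by simp
qed

text \<open>The bound involves \<open>T\<close> alone, so the order interval between 0 and
  \<open>T\<close> is bounded; this feeds the compactness of the set of tuples.\<close>

lemma norm_psd_le:
  fixes S T :: "real^'m::finite^'m"
  assumes "psd S" "psd (T - S)"
  shows "norm S \<le> (\<Sum>i\<in>UNIV. \<Sum>j\<in>UNIV. T $ i $ i + T $ j $ j)"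
proof -
  have "norm S \<le> (\<Sum>i\<in>UNIV. norm (S $ i))"
    unfolding norm_vec_def by (rule L2_set_le_sum) simp
  also have "\<dots> \<le> (\<Sum>i\<in>UNIV. \<Sum>j\<in>UNIV. \<bar>S $ i $ j\<bar>)"
    by (rule sum_mono) (rule norm_le_l1_cart)
  also have "\<dots> \<le> (\<Sum>i\<in>UNIV. \<Sum>j\<in>UNIV. T $ i $ i + T $ j $ j)"
    by (intro sum_mono psd_entry_bound assms)
  finally show ?thesis .
qed

text \<open>Phrased for a preimage so that it covers every Loewner constraint of \<open>Psi\<close>,
  each being affine in the tuple.\<close>

lemma closed_psd_preimage:
  fixes F :: "'b::topological_space \<Rightarrow> real^'m::finite^'m"
  assumes "\<And>i j. continuous_on UNIV (\<lambda>x. F x $ i $ j)"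
  shows "closed {x. psd (F x)}"
proof -
  have "{x. psd (F x)} = (\<Inter>i. \<Inter>j. {x. F x $ i $ j = F x $ j $ i}) \<inter>
      (\<Inter>y. {x. 0 \<le> (\<Sum>i\<in>UNIV. \<Sum>j\<in>UNIV. y $ i * (F x $ i $ j * y $ j))})"
    by (auto simp: psd_def symm_def quadratic_form_entries transpose_def vec_eq_iff)
  also have "closed \<dots>"
    by (intro closed_Int closed_INT ballI closed_Collect_eq closed_Collect_le continuous_intros assms)
  finally show ?thesis .
qed

section \<open>The finite-dimensional problem\<close>

text \<open>Coordinates outside \<open>{1..\<kappa>}\<close> are unconstrained in \<^const>\<open>Psi\<close>; they are set to zero
  to obtain a compact set of tuples.\<close>
lemma compact_Psi_restricted:
  fixes A :: "real^'m::finite^'m"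
  shows "compact (Psi \<kappa> A So \<inter> {S. \<forall>k. k \<notin> {1..\<kappa>} \<longrightarrow> S k = 0})"
proof -
  define R where "R k = (\<Sum>i\<in>UNIV. \<Sum>j\<in>UNIV. So k $ i $ i + So k $ j $ j)" for k
  define B :: "nat \<Rightarrow> (real^'m^'m) set" where "B k = (if k \<in> {1..\<kappa>} then cball 0 (R k) else {0})" for k
  \<comment> \<open>Tuples live in an infinite product, where closed and bounded is not enough;
    Tychonoff is applied to balls and singletons.\<close>
  have cB: "compact (PiE UNIV B)"
    using compactin_PiE[of "\<lambda>_. euclidean" UNIV B]
    by (auto simp: euclidean_product_topology B_def)
  have c1: "continuous_on UNIV (\<lambda>S::nat \<Rightarrow> real^'m^'m. S k $ i $ j)" for k i j
    by (intro continuous_on_component continuous_on_product_coordinates)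
  have c2: "continuous_on UNIV (\<lambda>S::nat \<Rightarrow> real^'m^'m. (A ** S k ** transpose A) $ i $ j)" for k i j
    by (simp only: matrix_matrix_mult_def vec_lambda_beta) (intro continuous_intros c1)
  have "Psi \<kappa> A So = (\<Inter>k\<in>{1..\<kappa>}. {S. psd (S k)}) \<inter> {S. psd (So 1 - S 1)} \<inter> {S. psd (S 1 - 0)}
      \<inter> (\<Inter>k\<in>{2..\<kappa>}. {S. psd (So k - S k)} \<inter> {S. psd (S k - A ** S (k - 1) ** transpose A)})"
    by (auto simp: Psi_def loewner_ge_def)
  also have "closed \<dots>"
    by (intro closed_Int closed_INT ballI closed_psd_preimage; (unfold vector_minus_component zero_index)?)
      (intro continuous_intros c1 c2)+
  finally have cl: "closed (Psi \<kappa> A So)" .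
  have "psd (S k)" "psd (So k - S k)" if "S \<in> Psi \<kappa> A So" "k \<in> {1..\<kappa>}" for S k
    using that by (cases "k = 1"; auto simp: Psi_def loewner_ge_def)+
  then have "Psi \<kappa> A So \<inter> {S. \<forall>k. k \<notin> {1..\<kappa>} \<longrightarrow> S k = 0} = PiE UNIV B \<inter> Psi \<kappa> A So
      \<inter> (\<Inter>k\<in>-{1..\<kappa>}. {S. S k = 0})"
    using norm_psd_le by (fastforce simp: B_def R_def PiE_UNIV_domain Pi_iff)
  moreover have "closed (\<Inter>k\<in>-{1..\<kappa>}. {S::nat \<Rightarrow> real^'m^'m. S k = 0})"
    by (intro closed_INT ballI closed_Collect_eq continuous_intros continuous_on_product_coordinates)
  ultimately show ?thesis
    using compact_Int_closed[OF compact_Int_closed[OF cB cl]] by simp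
qed

text \<open>The leader's cost at the vertex \<open>w\<close> of the simplex; \<open>game_obj\<close>
  is the supremum of its averages over types.\<close>

definition type_cost :: "nat \<Rightarrow> ('a \<Rightarrow> real) \<Rightarrow> (nat \<Rightarrow> 'a \<Rightarrow> real^'m^'m)
    \<Rightarrow> (nat \<Rightarrow> real^'m^'m) \<Rightarrow> 'a \<Rightarrow> real" where
  "type_cost \<kappa> xi Xi S w = xi w + (\<Sum>k=1..\<kappa>. trace (S k ** Xi k w))"

lemma matrix_mult_diff_right: "(S::real^'m::finite^'m) ** (X - Y) = S ** X - S ** Y"
  by (simp add: matrix_matrix_mult_def vec_eq_iff algebra_simps sum_subtractf)

text \<open>In this form the constraints of the problem for \<open>w\<close> say that
  \<open>w\<close> is a worst type at \<open>S\<close>.\<close>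

lemma type_cost_constraint_iff:
  "xi w' - xi w \<le> (\<Sum>k=1..\<kappa>. trace (S k ** (Xi k w - Xi k w')))
    \<longleftrightarrow> type_cost \<kappa> xi Xi S w' \<le> type_cost \<kappa> xi Xi S w"
  for Xi :: "nat \<Rightarrow> 'a \<Rightarrow> real^'m::finite^'m"
  by (auto simp: type_cost_def matrix_mult_diff_right trace_sub sum_subtractf)

lemma mu_w_eq:
  "mu_w W \<kappa> A So xi Xi w = (INF S\<in>{S\<in>Psi \<kappa> A So. \<forall>w'\<in>W. type_cost \<kappa> xi Xi S w' \<le> type_cost \<kappa> xi Xi S w}.
      ereal (type_cost \<kappa> xi Xi S w))"
  unfolding mu_w_def type_cost_constraint_iff
  by (simp only: type_cost_def trace_mul_sym[of "Xi _ _"])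

lemma SUP_prob_simplex:
  fixes f :: "'a \<Rightarrow> real"
  assumes fin: "finite W" and w: "w \<in> W" and max: "\<And>w'. w' \<in> W \<Longrightarrow> f w' \<le> f w"
  shows "(SUP p\<in>prob_simplex W. \<Sum>w\<in>W. p w * f w) = f w"
proof (rule cSup_eq_maximum)
  have "(\<Sum>w'\<in>W. (if w' = w then 1 else 0) * f w') = (\<Sum>w'\<in>W. if w' = w then f w' else 0)"
    by (rule sum.cong) auto
  then have "f w = (\<Sum>w'\<in>W. (if w' = w then 1 else 0) * f w')"
    using fin w by simp
  moreover have "(\<lambda>w'. if w' = w then 1 else 0) \<in> prob_simplex W"
    using fin w by (simp add: prob_simplex_def)
  ultimately show "f w \<in> (\<lambda>p. \<Sum>w\<in>W. p w * f w) ` prob_simplex W" by (rule image_eqI)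
next
  fix y assume "y \<in> (\<lambda>p. \<Sum>w\<in>W. p w * f w) ` prob_simplex W"
  then obtain p where p: "p \<in> prob_simplex W" and y: "y = (\<Sum>w\<in>W. p w * f w)" by blast
  have "y \<le> (\<Sum>w'\<in>W. p w' * f w)"
    unfolding y using p max by (intro sum_mono mult_left_mono) (auto simp: prob_simplex_def)
  also have "\<dots> = f w"
    using p by (simp add: prob_simplex_def flip: sum_distrib_right)
  finally show "y \<le> f w" .
qed

lemma game_obj_eq_type_cost:
  assumes "finite W" "w \<in> W" "\<And>w'. w' \<in> W \<Longrightarrow> type_cost \<kappa> xi Xi S w' \<le> type_cost \<kappa> xi Xi S w"
  shows "game_obj W \<kappa> xi Xi S = type_cost \<kappa> xi Xi S w"
  using SUP_prob_simplex[OF assms(1,2), of "type_cost \<kappa> xi Xi S"] assms(3)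
  by (simp add: game_obj_def type_cost_def)

lemma finite_maximizer:
  fixes f :: "'a \<Rightarrow> real"
  assumes "finite W" "W \<noteq> {}"
  obtains w where "w \<in> W" "\<And>w'. w' \<in> W \<Longrightarrow> f w' \<le> f w"
  using Max_in[of "f ` W"] Max_ge[of "f ` W"] assms by fastforce

lemma Min_mu_w_le_game_obj:
  fixes A :: "real^'m::finite^'m"
  assumes "finite W" "W \<noteq> {}" "S \<in> Psi \<kappa> A So"
  shows "Min (mu_w W \<kappa> A So xi Xi ` W) \<le> ereal (game_obj W \<kappa> xi Xi S)"
proof -
  obtain w where w: "w \<in> W" "\<And>w'. w' \<in> W \<Longrightarrow> type_cost \<kappa> xi Xi S w' \<le> type_cost \<kappa> xi Xi S w"
    using finite_maximizer[OF assms(1,2), of "type_cost \<kappa> xi Xi S"] by blast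
  have "Min (mu_w W \<kappa> A So xi Xi ` W) \<le> mu_w W \<kappa> A So xi Xi w"
    using assms(1) w(1) by simp
  also have "\<dots> \<le> ereal (type_cost \<kappa> xi Xi S w)"
    unfolding mu_w_eq using w assms(3) by (intro INF_lower) simp
  also have "\<dots> = ereal (game_obj W \<kappa> xi Xi S)"
    using game_obj_eq_type_cost[OF assms(1) w] by simp
  finally show ?thesis .
qed

text \<open>The feasible set itself is not compact, its irrelevant coordinates being free. Resetting
  these by \<open>r\<close> preserves the cost and lands in the compact set \<open>K\<close>, so a
  minimizer over \<open>K\<close> is a minimizer overall.\<close>

lemma mu_w_attained:
  fixes A :: "real^'m::finite^'m"
  assumes ne: "S0 \<in> Psi \<kappa> A So" "\<forall>w'\<in>W. type_cost \<kappa> xi Xi S0 w' \<le> type_cost \<kappa> xi Xi S0 w"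
  obtains S where "S \<in> Psi \<kappa> A So" "\<forall>w'\<in>W. type_cost \<kappa> xi Xi S w' \<le> type_cost \<kappa> xi Xi S w"
    "mu_w W \<kappa> A So xi Xi w = ereal (type_cost \<kappa> xi Xi S w)"
proof -
  define F where "F = {S\<in>Psi \<kappa> A So. \<forall>w'\<in>W. type_cost \<kappa> xi Xi S w' \<le> type_cost \<kappa> xi Xi S w}"
  define K where "K = Psi \<kappa> A So \<inter> {S. \<forall>k. k \<notin> {1..\<kappa>} \<longrightarrow> S k = 0}
      \<inter> (\<Inter>w'\<in>W. {S. type_cost \<kappa> xi Xi S w' \<le> type_cost \<kappa> xi Xi S w})"
  define r :: "(nat \<Rightarrow> real^'m^'m) \<Rightarrow> nat \<Rightarrow> real^'m^'m"
    where "r S k = (if k \<in> {1..\<kappa>} then S k else 0)" for S k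
  have cont: "continuous_on UNIV (\<lambda>S. type_cost \<kappa> xi Xi S w')" for w'
    unfolding type_cost_def trace_def matrix_matrix_mult_def
    by (simp, intro continuous_intros continuous_on_component continuous_on_product_coordinates)
  have cost_r: "type_cost \<kappa> xi Xi (r S) = type_cost \<kappa> xi Xi S" for S
    by (simp add: type_cost_def r_def fun_eq_iff)
  have Psi_1: "r S \<in> Psi \<kappa> A So" if "S \<in> Psi \<kappa> A So" for S
  \<comment> \<open>\<open>Psi\<close> constrains \<open>S 1\<close> even for an empty horizon,
    where \<open>r\<close> resets it to 0; then \<open>So 1\<close> is semidefinite as the sum of
    \<open>So 1 - S 1\<close> and \<open>S 1\<close>.\<close>
  proof (cases "\<kappa> = 0")
    case False
    with that show ?thesis
      by (auto simp: Psi_def r_def)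
  next
    case True
    with that show ?thesis
      by (auto simp: Psi_def r_def loewner_ge_def psd_zero dest: psd_add)
  qed
  have rK: "r S \<in> K" if "S \<in> F" for S
    using that Psi_1 by (auto simp: K_def F_def cost_r) (simp_all add: r_def)
  have "compact K"
    unfolding K_def
    by (intro compact_Int_closed compact_Psi_restricted closed_INT ballI closed_Collect_le cont)
  moreover have "K \<noteq> {}" using ne rK by (auto simp: F_def)
  ultimately obtain S where S: "S \<in> K" "\<forall>T\<in>K. type_cost \<kappa> xi Xi S w \<le> type_cost \<kappa> xi Xi T w"
    using continuous_attains_inf[of K "\<lambda>S. type_cost \<kappa> xi Xi S w"] cont continuous_on_subset by blast
  have "S \<in> F" using S(1) by (auto simp: K_def F_def)
  moreover have "(INF S\<in>F. ereal (type_cost \<kappa> xi Xi S w)) = ereal (type_cost \<kappa> xi Xi S w)"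
  proof (rule INF_eqI)
    fix T assume "T \<in> F"
    then show "ereal (type_cost \<kappa> xi Xi S w) \<le> ereal (type_cost \<kappa> xi Xi T w)"
      using S(2) rK[of T] by (metis cost_r ereal_less_eq(3))
  qed (use \<open>S \<in> F\<close> in blast)
  ultimately show ?thesis
    by (intro that[of S]) (auto simp: F_def mu_w_eq)
qed

lemma game_obj_attains_Min_mu_w:
  fixes A :: "real^'m::finite^'m"
  assumes fin: "finite W" "W \<noteq> {}" and ne: "Psi \<kappa> A So \<noteq> {}"
  obtains S where "S \<in> Psi \<kappa> A So"
    "ereal (game_obj W \<kappa> xi Xi S) = Min (mu_w W \<kappa> A So xi Xi ` W)"
proof -
  obtain S0 where S0: "S0 \<in> Psi \<kappa> A So" using ne by blast
  have "Min (mu_w W \<kappa> A So xi Xi ` W) \<in> mu_w W \<kappa> A So xi Xi ` W"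
    using fin by (intro Min_in) auto
  then obtain w where w: "w \<in> W" "Min (mu_w W \<kappa> A So xi Xi ` W) = mu_w W \<kappa> A So xi Xi w" by blast
  \<comment> \<open>An empty feasible set would give the value infinity, whereas any tuple in
    \<open>Psi\<close> bounds the smallest value by a real number; so the minimizing type has a
    feasible tuple.\<close>
  have "mu_w W \<kappa> A So xi Xi w < \<infinity>"
    using Min_mu_w_le_game_obj[OF fin S0, of xi Xi] w(2) le_less_trans[OF _ ereal_less_PInfty] by auto
  then have "{S\<in>Psi \<kappa> A So. \<forall>w'\<in>W. type_cost \<kappa> xi Xi S w' \<le> type_cost \<kappa> xi Xi S w} \<noteq> {}"
    unfolding mu_w_eq by (metis image_empty Inf_empty top_ereal_def less_irrefl)
  then obtain S1 where "S1 \<in> Psi \<kappa> A So" "\<forall>w'\<in>W. type_cost \<kappa> xi Xi S1 w' \<le> type_cost \<kappa> xi Xi S1 w"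
    by blast
  then obtain S where S: "S \<in> Psi \<kappa> A So" "\<forall>w'\<in>W. type_cost \<kappa> xi Xi S w' \<le> type_cost \<kappa> xi Xi S w"
    "mu_w W \<kappa> A So xi Xi w = ereal (type_cost \<kappa> xi Xi S w)" by (rule mu_w_attained)
  then show ?thesis
    using that[of S] w game_obj_eq_type_cost[OF fin(1) w(1), of \<kappa> xi Xi S] by simp
qed

section \<open>Characteristic functions and independence\<close>

context prob_space
begin

text \<open>The signed measure with density \<open>h\<close>, pushed forward by \<open>Y\<close>,
  has vanishing Fourier transform. Its positive and negative parts, rescaled to probability
  measures, then share a characteristic function and agree by Levy's theorem.\<close>

lemma fourier_zero_imp_indicator_zero_real:
  fixes h Y :: "'a \<Rightarrow> real"
  assumes h: "integrable M h" and Y[measurable]: "random_variable borel Y"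
    and cos0: "\<And>t. expectation (\<lambda>\<omega>. h \<omega> * cos (t * Y \<omega>)) = 0"
    and sin0: "\<And>t. expectation (\<lambda>\<omega>. h \<omega> * sin (t * Y \<omega>)) = 0"
    and B[measurable]: "B \<in> sets borel"
  shows "expectation (\<lambda>\<omega>. h \<omega> * indicator B (Y \<omega>)) = 0"
proof -
  have hm[measurable]: "h \<in> borel_measurable M" using h by simp
  define hp where "hp \<omega> = max 0 (h \<omega>)" for \<omega>
  define hn where "hn \<omega> = max 0 (- h \<omega>)" for \<omega>
  define c where "c = expectation hp"
  have int: "integrable M hp" "integrable M hn"
    using h unfolding hp_def[abs_def] hn_def[abs_def] by auto
  have diff: "h \<omega> = hp \<omega> - hn \<omega>" for \<omega> by (simp add: hp_def hn_def)
  \<comment> \<open>The transform at 0 shows that both parts have the same mass, so one constant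
    \<open>c\<close> normalizes both.\<close>
  have "expectation h = 0" using cos0[of 0] by simp
  then have cn: "expectation hn = c"
    using int by (simp add: diff[abs_def] c_def)
  have nonneg: "0 \<le> hp \<omega>" "0 \<le> hn \<omega>" for \<omega> by (simp_all add: hp_def hn_def)
  show ?thesis
  \<comment> \<open>Zero mass cannot be normalized, but then \<open>h\<close> vanishes almost
    everywhere.\<close>
  proof (cases "c = 0")
    case True
    then have "AE \<omega> in M. hp \<omega> = 0" "AE \<omega> in M. hn \<omega> = 0"
      using integral_nonneg_eq_0_iff_AE[OF int(1)] integral_nonneg_eq_0_iff_AE[OF int(2)] cn nonneg
      by (auto simp: c_def)
    then have "AE \<omega> in M. h \<omega> * indicator B (Y \<omega>) = 0"
      by eventually_elim (simp add: diff)
    then show ?thesis by (simp add: integral_eq_zero_AE)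
  next
    case False
    moreover have "0 \<le> c" unfolding c_def by (intro integral_nonneg_AE) (simp add: nonneg)
    ultimately have c: "0 < c" by simp
    define N where "N g = distr (density M (\<lambda>\<omega>. ennreal (g \<omega> / c))) borel Y" for g
    have N: "real_distribution (N g)"
      and integral_N: "\<And>f::real \<Rightarrow> complex. f \<in> borel_measurable borel \<Longrightarrow>
        integral\<^sup>L (N g) f = integral\<^sup>L M (\<lambda>\<omega>. (g \<omega> / c) *\<^sub>R f (Y \<omega>))"
      and measure_N: "measure (N g) B = integral\<^sup>L M (\<lambda>\<omega>. (g \<omega> / c) * indicator B (Y \<omega>))"
      if g: "integrable M g" "expectation g = c" "\<And>\<omega>. 0 \<le> g \<omega>" for g
    proof -
      have [measurable]: "g \<in> borel_measurable M" using g(1) by simp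
      interpret D: prob_space "density M (\<lambda>\<omega>. ennreal (g \<omega> / c))"
      proof
        have "(\<integral>\<^sup>+ \<omega>. ennreal (g \<omega> / c) \<partial>M) = ennreal (expectation (\<lambda>\<omega>. g \<omega> / c))"
          using g c by (intro nn_integral_eq_integral) auto
        also have "\<dots> = 1" using g c by simp
        finally show "emeasure (density M (\<lambda>\<omega>. ennreal (g \<omega> / c))) (space (density M (\<lambda>\<omega>. ennreal (g \<omega> / c)))) = 1"
          by (simp add: emeasure_density cong: nn_integral_cong_simp)
      qed
      show "real_distribution (N g)"
        unfolding N_def by (rule D.real_distribution_distr) simp
      show "integral\<^sup>L (N g) f = integral\<^sup>L M (\<lambda>\<omega>. (g \<omega> / c) *\<^sub>R f (Y \<omega>))"
        if [measurable]: "f \<in> borel_measurable borel" for f :: "real \<Rightarrow> complex"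
        using g c by (simp add: N_def integral_distr integral_density)
      have "measure (N g) B = integral\<^sup>L (N g) (indicator B)"
        by (simp add: N_def)
      also have "\<dots> = integral\<^sup>L M (\<lambda>\<omega>. (g \<omega> / c) *\<^sub>R indicator B (Y \<omega>))"
        using g c unfolding N_def by (subst integral_distr, simp, simp) (subst integral_density, auto)
      finally show "measure (N g) B = integral\<^sup>L M (\<lambda>\<omega>. (g \<omega> / c) * indicator B (Y \<omega>))"
        by simp
    qed
    have "char (N hp) = char (N hn)"
    proof
      fix t
      have i: "integrable M (\<lambda>\<omega>. g \<omega> *\<^sub>R iexp (t * Y \<omega>))" if "integrable M g" for g :: "'a \<Rightarrow> real"
        by (rule Bochner_Integration.integrable_bound[OF that]) (use that in \<open>auto simp: \<close>)
      have "(CLINT \<omega>|M. h \<omega> *\<^sub>R iexp (t * Y \<omega>)) = 0"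
        using cos0[of t] sin0[of t] i[OF h] unfolding cis_conv_exp[symmetric]
        by (simp add: complex_eq_iff flip: integral_Re integral_Im)
      then have "(CLINT \<omega>|M. hp \<omega> *\<^sub>R iexp (t * Y \<omega>)) = (CLINT \<omega>|M. hn \<omega> *\<^sub>R iexp (t * Y \<omega>))"
        using i[OF int(1)] i[OF int(2)] unfolding diff by (simp add: scaleR_diff_left)
      then show "char (N hp) t = char (N hn) t"
        using int cn nonneg by (simp add: char_def integral_N c_def[symmetric] divide_inverse mult.commute
            flip: scaleR_scaleR)
    qed
    then have "N hp = N hn"
      using N int cn nonneg by (intro Levy_uniqueness) (auto simp: c_def)
    then have "expectation (\<lambda>\<omega>. hp \<omega> / c * indicator B (Y \<omega>)) = expectation (\<lambda>\<omega>. hn \<omega> / c * indicator B (Y \<omega>))"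
      using measure_N[OF int(1)] measure_N[OF int(2)] cn nonneg by (auto simp: c_def)
    moreover have "integrable M (\<lambda>\<omega>. g \<omega> * indicator B (Y \<omega>))" if "integrable M g" for g :: "'a \<Rightarrow> real"
      by (rule Bochner_Integration.integrable_bound[OF that])
        (use that in \<open>auto simp: indicator_def\<close>)
    ultimately show ?thesis
      using int c by (simp add: diff left_diff_distrib)
  qed
qed

text \<open>Complex weights occur because the induction over several variables absorbs exponentials
  into the weight. The values at \<open>t\<close> and \<open>- t\<close> give the cosine and sine
  transforms; these test functions are real, so \<open>Re C\<close> and \<open>Im C\<close>
  separate.\<close>

lemma fourier_zero_imp_indicator_zero:
  fixes C :: "'a \<Rightarrow> complex" and Y :: "'a \<Rightarrow> real"
  assumes C: "integrable M C" and Y[measurable]: "random_variable borel Y"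
    and zero: "\<And>t. (CLINT \<omega>|M. C \<omega> * iexp (t * Y \<omega>)) = 0"
    and B[measurable]: "B \<in> sets borel"
  shows "(CLINT \<omega>|M. C \<omega> * of_real (indicator B (Y \<omega>))) = 0"
proof -
  have [measurable]: "C \<in> borel_measurable M" using C by simp
  have i: "integrable M (\<lambda>\<omega>. C \<omega> * g \<omega>)"
    if "\<And>\<omega>. norm (g \<omega>) \<le> 1" "g \<in> borel_measurable M" for g :: "'a \<Rightarrow> complex"
    by (rule Bochner_Integration.integrable_bound[OF C])
      (use that in \<open>auto simp: norm_mult mult_left_le\<close>)
  have e: "integrable M (\<lambda>\<omega>. C \<omega> * iexp (t * Y \<omega>))" for t
    by (rule i) auto
  have cos0: "(CLINT \<omega>|M. C \<omega> * of_real (cos (t * Y \<omega>))) = 0" for t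
  proof -
    have "c * of_real (cos u) = (c * iexp u + c * iexp (- u)) / 2" for c u
      unfolding cis_conv_exp[symmetric] by (simp add: complex_eq_iff)
    from this[of "C _" "t * Y _"]
    have eq: "C \<omega> * of_real (cos (t * Y \<omega>)) = (C \<omega> * iexp (t * Y \<omega>) + C \<omega> * iexp ((- t) * Y \<omega>)) / 2" for \<omega>
      by simp
    show ?thesis unfolding eq using e[of t] e[of "- t"] zero[of t] zero[of "- t"] by simp
  qed
  have sin0: "(CLINT \<omega>|M. C \<omega> * of_real (sin (t * Y \<omega>))) = 0" for t
  proof -
    have "c * of_real (sin u) = (c * iexp u - c * iexp (- u)) / (2 * \<i>)" for c u
      unfolding cis_conv_exp[symmetric] by (simp add: complex_eq_iff Re_divide Im_divide power2_eq_square)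
    from this[of "C _" "t * Y _"]
    have eq: "C \<omega> * of_real (sin (t * Y \<omega>)) = (C \<omega> * iexp (t * Y \<omega>) - C \<omega> * iexp ((- t) * Y \<omega>)) / (2 * \<i>)" for \<omega>
      by simp
    show ?thesis unfolding eq using e[of t] e[of "- t"] zero[of t] zero[of "- t"] by simp
  qed
  have Re: "expectation (\<lambda>\<omega>. Re (C \<omega>) * g \<omega>) = 0 \<and> expectation (\<lambda>\<omega>. Im (C \<omega>) * g \<omega>) = 0"
    if "(CLINT \<omega>|M. C \<omega> * of_real (g \<omega>)) = 0" "\<And>\<omega>. norm (g \<omega>) \<le> 1" "g \<in> borel_measurable M" for g :: "'a \<Rightarrow> real"
  proof -
    have "integrable M (\<lambda>\<omega>. C \<omega> * of_real (g \<omega>))"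
      using that(2,3) by (intro i) auto
    from integral_Re[OF this] integral_Im[OF this] show ?thesis
      using that(1) by simp
  qed
  have "expectation (\<lambda>\<omega>. Re (C \<omega>) * indicator B (Y \<omega>)) = 0"
    by (rule fourier_zero_imp_indicator_zero_real) (use C Re[OF cos0] Re[OF sin0] in auto)
  moreover have "expectation (\<lambda>\<omega>. Im (C \<omega>) * indicator B (Y \<omega>)) = 0"
    by (rule fourier_zero_imp_indicator_zero_real) (use C Re[OF cos0] Re[OF sin0] in auto)
  moreover have "integrable M (\<lambda>\<omega>. C \<omega> * of_real (indicator B (Y \<omega>)))"
    by (intro i) (auto simp: indicator_def)
  ultimately show ?thesis
    by (simp add: complex_eq_iff flip: integral_Re integral_Im)
qed

text \<open>One variable at a time, this reduces the multivariate uniqueness theorem for characteristic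
  functions to Levy's theorem on the line.\<close>
lemma fourier_zero_imp_indicators_zero:
  fixes C :: "'a \<Rightarrow> complex" and Y :: "'i \<Rightarrow> 'a \<Rightarrow> real"
  assumes "finite J" "integrable M C" "\<And>p. p \<in> J \<Longrightarrow> random_variable borel (Y p)"
    "\<And>t. (CLINT \<omega>|M. C \<omega> * (\<Prod>p\<in>J. iexp (t p * Y p \<omega>))) = 0"
    "\<And>p. B p \<in> sets borel"
  shows "(CLINT \<omega>|M. C \<omega> * (\<Prod>p\<in>J. of_real (indicator (B p) (Y p \<omega>)))) = 0"
  using assms
proof (induction J arbitrary: C rule: finite_induct)
  case (insert q J)
  note [measurable] = insert.prems(4)
  have Ym: "random_variable borel (Y p)" if "p \<in> insert q J" for p using insert.prems(2) that .
  have [measurable]: "random_variable borel (Y q)" by (rule Ym) simp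
  have Cm[measurable]: "C \<in> borel_measurable M" using insert.prems(1) by simp
  \<comment> \<open>The exponential of the new variable is absorbed into the weight, so the
    induction hypothesis turns the others into indicators; these then join the weight and the
    one-variable lemma treats \<open>Y q\<close>.\<close>
  have "(CLINT \<omega>|M. (C \<omega> * iexp (s * Y q \<omega>)) * (\<Prod>p\<in>J. of_real (indicator (B p) (Y p \<omega>)))) = 0" for s
  proof (rule insert.IH)
    show "integrable M (\<lambda>\<omega>. C \<omega> * iexp (s * Y q \<omega>))"
      by (rule Bochner_Integration.integrable_bound[OF insert.prems(1)]) (auto simp: norm_mult)
    fix t
    have "(\<Prod>p\<in>insert q J. iexp ((t(q := s)) p * Y p \<omega>)) = iexp (s * Y q \<omega>) * (\<Prod>p\<in>J. iexp (t p * Y p \<omega>))" for \<omega>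
      using insert.hyps by (auto intro!: prod.cong)
    then show "(CLINT \<omega>|M. C \<omega> * iexp (s * Y q \<omega>) * (\<Prod>p\<in>J. iexp (t p * Y p \<omega>))) = 0"
      using insert.prems(3)[of "t(q := s)"] by (simp add: mult.assoc)
  qed (use Ym insert.prems(4) in auto)
  then have "(CLINT \<omega>|M. (C \<omega> * (\<Prod>p\<in>J. of_real (indicator (B p) (Y p \<omega>)))) * of_real (indicator (B q) (Y q \<omega>))) = 0"
  proof (intro fourier_zero_imp_indicator_zero)
    have "norm (\<Prod>p\<in>J. complex_of_real (indicator (B p) (Y p \<omega>))) \<le> 1" for \<omega>
      unfolding prod_norm[symmetric] by (intro prod_le_1) (auto simp: indicator_def)
    moreover have "(\<lambda>\<omega>. \<Prod>p\<in>J. complex_of_real (indicator (B p) (Y p \<omega>))) \<in> borel_measurable M"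
      using Ym by (intro borel_measurable_prod) auto
    ultimately show "integrable M (\<lambda>\<omega>. C \<omega> * (\<Prod>p\<in>J. of_real (indicator (B p) (Y p \<omega>))))"
      by (intro Bochner_Integration.integrable_bound[OF insert.prems(1)])
        (auto simp: norm_mult mult_left_le)
  qed (auto simp: ac_simps)
  then show ?case using insert.hyps by (simp add: ac_simps)
qed simp

end

context prob_space
begin

text \<open>The factorization makes \<open>Z\<close> independent of the sigma-algebra of the
  \<open>Y p\<close>. Exponentials are exchanged for indicators in two rounds, first in the
  \<open>Y p\<close>, then in \<open>Z\<close>; the boxes are stable under intersection, so
  independence extends to what they generate.\<close>

lemma integral_indicator_mult_indep:
  fixes Z :: "'a \<Rightarrow> real"
  assumes Y: "finite J" "\<And>p. p \<in> J \<Longrightarrow> random_variable borel (Y p)"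
    and Z[measurable]: "integrable M Z"
    and fact: "\<And>s t. (CLINT \<omega>|M. iexp (s * Z \<omega>) * (\<Prod>p\<in>J. iexp (t p * Y p \<omega>)))
      = (CLINT \<omega>|M. iexp (s * Z \<omega>)) * (CLINT \<omega>|M. (\<Prod>p\<in>J. iexp (t p * Y p \<omega>)))"
    and A: "A \<in> sigma_sets (space M) {{\<omega>\<in>space M. \<forall>p\<in>J. Y p \<omega> \<in> B p} | B. \<forall>p. B p \<in> sets borel}"
      (is "A \<in> sigma_sets _ ?E")
  shows "expectation (\<lambda>\<omega>. indicator A \<omega> * Z \<omega>) = prob A * expectation Z"
proof -
  have Zm[measurable]: "random_variable borel Z" using Z by simp
  have Ym[measurable]: "random_variable borel (Y p)" if "p \<in> J" for p using Y(2) that .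
  define D where "D = {Z -` B \<inter> space M | B. B \<in> sets borel}"
  have bound: "integrable M f" if "f \<in> borel_measurable M" "\<And>\<omega>. norm (f \<omega>) \<le> 1" for f :: "'a \<Rightarrow> complex"
    using that by (intro integrable_const_bound[where B = 1]) auto
  have prod_m: "(\<lambda>\<omega>. \<Prod>p\<in>J. iexp (t p * Y p \<omega>)) \<in> borel_measurable M" for t
    by (intro borel_measurable_prod) simp
  have E_events: "?E \<subseteq> events"
    using Y(1) by auto
  have "prob (a \<inter> b) = prob a * prob b" if "a \<in> ?E" "b \<in> D" for a b
  proof -
    obtain B where a: "a = {\<omega>\<in>space M. \<forall>p\<in>J. Y p \<omega> \<in> B p}" and B: "\<And>p. B p \<in> sets borel"
      using \<open>a \<in> ?E\<close> by blast
    obtain B' where b: "b = Z -` B' \<inter> space M" and B'[measurable]: "B' \<in> sets borel"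
      using \<open>b \<in> D\<close> by (auto simp: D_def)
    have a_ev[measurable]: "a \<in> events" using E_events \<open>a \<in> ?E\<close> by blast
    have b_ev[measurable]: "b \<in> events" unfolding b by simp
    have ind_a: "(\<Prod>p\<in>J. complex_of_real (indicator (B p) (Y p \<omega>))) = of_real (indicator a \<omega>)"
      if "\<omega> \<in> space M" for \<omega>
    proof (cases "\<omega> \<in> a")
      case True
      then show ?thesis by (simp add: a)
    next
      case False
      with that have "\<exists>p\<in>J. Y p \<omega> \<notin> B p" by (auto simp: a)
      then have "(\<Prod>p\<in>J. complex_of_real (indicator (B p) (Y p \<omega>))) = 0"
        using Y(1) by (intro prod_zero) (auto simp: indicator_def)
      with False show ?thesis by simp
    qed
    have int_a: "(CLINT \<omega>|M. of_real (indicator a \<omega>)) = complex_of_real (prob a)"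
      by simp
    have ch: "(CLINT \<omega>|M. of_real (indicator a \<omega>) * iexp (s * Z \<omega>)) = of_real (prob a) * (CLINT \<omega>|M. iexp (s * Z \<omega>))" for s
    proof -
      define c where "c = (CLINT \<omega>|M. iexp (s * Z \<omega>))"
      \<comment> \<open>Subtracting \<open>c\<close> turns the factorization into a vanishing
        transform; below, subtracting \<open>prob a\<close> does the same with the roles of
        \<open>Z\<close> and the \<open>Y p\<close> exchanged.\<close>
      have "(CLINT \<omega>|M. (iexp (s * Z \<omega>) - c) * (\<Prod>p\<in>J. of_real (indicator (B p) (Y p \<omega>)))) = 0"
      proof (rule fourier_zero_imp_indicators_zero[OF Y(1)])
        show "integrable M (\<lambda>\<omega>. iexp (s * Z \<omega>) - c)"
          by (rule Bochner_Integration.integrable_diff[OF bound]) auto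
        fix t
        have "integrable M (\<lambda>\<omega>. iexp (s * Z \<omega>) * (\<Prod>p\<in>J. iexp (t p * Y p \<omega>)))"
          "integrable M (\<lambda>\<omega>. \<Prod>p\<in>J. iexp (t p * Y p \<omega>))"
          using prod_m[of t] by (auto intro!: bound simp: norm_mult simp flip: prod_norm)
        then show "(CLINT \<omega>|M. (iexp (s * Z \<omega>) - c) * (\<Prod>p\<in>J. iexp (t p * Y p \<omega>))) = 0"
          using fact[of s t] by (simp add: left_diff_distrib c_def)
      qed (use Y B in auto)
      also have "(CLINT \<omega>|M. (iexp (s * Z \<omega>) - c) * (\<Prod>p\<in>J. of_real (indicator (B p) (Y p \<omega>))))
          = (CLINT \<omega>|M. of_real (indicator a \<omega>) * iexp (s * Z \<omega>) - c * of_real (indicator a \<omega>))"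
        by (rule Bochner_Integration.integral_cong) (simp_all add: ind_a algebra_simps)
      also have "\<dots> = (CLINT \<omega>|M. of_real (indicator a \<omega>) * iexp (s * Z \<omega>)) - c * of_real (prob a)"
        unfolding int_a[symmetric]
        by (subst Bochner_Integration.integral_diff)
          (auto intro!: bound integrable_mult_right simp: norm_mult indicator_def)
      finally show ?thesis by (simp add: c_def mult.commute)
    qed
    have "(CLINT \<omega>|M. (of_real (indicator a \<omega>) - of_real (prob a)) * of_real (indicator B' (Z \<omega>))) = 0"
    proof (rule fourier_zero_imp_indicator_zero)
      show "integrable M (\<lambda>\<omega>. complex_of_real (indicator a \<omega>) - of_real (prob a))"
        by (intro Bochner_Integration.integrable_diff bound) (auto simp: indicator_def)
      fix s
      have "(CLINT \<omega>|M. (of_real (indicator a \<omega>) - of_real (prob a)) * iexp (s * Z \<omega>))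
        = (CLINT \<omega>|M. of_real (indicator a \<omega>) * iexp (s * Z \<omega>)) - of_real (prob a) * (CLINT \<omega>|M. iexp (s * Z \<omega>))"
        unfolding left_diff_distrib
        by (subst Bochner_Integration.integral_diff)
          (auto intro!: bound integrable_mult_right simp: norm_mult indicator_def)
      then show "(CLINT \<omega>|M. (of_real (indicator a \<omega>) - of_real (prob a)) * iexp (s * Z \<omega>)) = 0"
        using ch by simp
    qed auto
    also have "(CLINT \<omega>|M. (of_real (indicator a \<omega>) - of_real (prob a)) * of_real (indicator B' (Z \<omega>)))
      = (CLINT \<omega>|M. of_real (indicator (a \<inter> b) \<omega> - prob a * indicator b \<omega>))"
      by (rule Bochner_Integration.integral_cong) (auto simp: b indicator_def)
    also have "\<dots> = of_real (prob (a \<inter> b) - prob a * prob b)"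
      by (subst integral_complex_of_real) (simp add: less_top[symmetric])
    finally show ?thesis by (simp del: of_real_diff of_real_mult)
  qed
  then have "indep_set ?E D"
    using E_events by (intro indep_setI) (auto simp: D_def)
  moreover have "Int_stable ?E"
  proof (rule Int_stableI)
    fix a b assume "a \<in> ?E" "b \<in> ?E"
    then obtain B B' where "a = {\<omega>\<in>space M. \<forall>p\<in>J. Y p \<omega> \<in> B p}" "\<forall>p. B p \<in> sets borel"
      "b = {\<omega>\<in>space M. \<forall>p\<in>J. Y p \<omega> \<in> B' p}" "\<forall>p. B' p \<in> sets borel" by blast
    then show "a \<inter> b \<in> ?E"
      by (intro CollectI exI[of _ "\<lambda>p. B p \<inter> B' p"]) auto
  qed
  moreover have "Int_stable D"
  proof (rule Int_stableI)
    fix a b assume "a \<in> D" "b \<in> D"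
    then obtain B B' where "a = Z -` B \<inter> space M" "B \<in> sets borel" "b = Z -` B' \<inter> space M" "B' \<in> sets borel"
      unfolding D_def by blast
    then show "a \<inter> b \<in> D"
      unfolding D_def by (intro CollectI exI[of _ "B \<inter> B'"]) auto
  qed
  ultimately have ind: "indep_set (sigma_sets (space M) ?E) (sigma_sets (space M) D)"
    by (rule indep_set_sigma_sets)
  have EP: "?E \<subseteq> Pow (space M)" by auto
  have A_ev[measurable]: "A \<in> events"
    using A sets.sigma_sets_subset[OF E_events] by blast
  let ?F = "sigma (space M) ?E"
  \<comment> \<open>The product rule for expectations speaks of random variables, so the event
    enters as its indicator, whose sigma-algebra lies in that of the boxes.\<close>
  have "(indicator A :: 'a \<Rightarrow> real) \<in> borel_measurable ?F"
    using A EP by (intro borel_measurable_indicator) (simp add: sets_measure_of)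
  then have gen: "{(indicator A :: 'a \<Rightarrow> real) -` B \<inter> space M | B. B \<in> sets borel} \<subseteq> sets ?F"
    using EP by (auto dest: measurable_sets)
  have "sigma_sets (space M) {(indicator A :: 'a \<Rightarrow> real) -` B \<inter> space M | B. B \<in> sets borel} \<subseteq> sigma_sets (space M) ?E"
    using sets.sigma_sets_subset[OF gen] EP by (simp add: sets_measure_of space_measure_of)
  then have "indep_var borel (indicator A :: 'a \<Rightarrow> real) borel Z"
    using ind unfolding indep_var_eq D_def indep_sets2_eq by auto
  moreover have "integrable M (indicator A :: 'a \<Rightarrow> real)"
    by (simp add: less_top[symmetric])
  ultimately have "expectation (\<lambda>\<omega>. indicator A \<omega> * Z \<omega>) = expectation (indicator A) * expectation Z"
    using Z by (intro indep_var_lebesgue_integral)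
  then show ?thesis by simp
qed

end

lemma abs_mult_le_sum_squares: "\<bar>x * y\<bar> \<le> x\<^sup>2 + y\<^sup>2" for x y :: real
  using sum_squares_ge_zero[of x y] zero_le_power2[of "x - y"] zero_le_power2[of "x + y"]
  by (simp add: power2_eq_square algebra_simps abs_le_iff)

section \<open>Gaussian spaces\<close>

text \<open>A linear space of centred square-integrable variables each of which is normal; being closed
  under linear combinations, it makes all its finite families jointly Gaussian.\<close>
locale gaussian_space = prob_space M for M :: "'a measure" +
  fixes G :: "('a \<Rightarrow> real) set"
  assumes G_zero: "(\<lambda>_. 0) \<in> G"
    and G_add: "f \<in> G \<Longrightarrow> g \<in> G \<Longrightarrow> (\<lambda>\<omega>. f \<omega> + g \<omega>) \<in> G"
    and G_scale: "f \<in> G \<Longrightarrow> (\<lambda>\<omega>. c * f \<omega>) \<in> G"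
    and G_square_integrable: "f \<in> G \<Longrightarrow> integrable M (\<lambda>\<omega>. (f \<omega>)\<^sup>2)"
    and G_integrable: "f \<in> G \<Longrightarrow> integrable M f"
    and G_mean: "f \<in> G \<Longrightarrow> expectation f = 0"
    and G_char: "f \<in> G \<Longrightarrow> (CLINT \<omega>|M. iexp (f \<omega>)) = of_real (exp (- expectation (\<lambda>\<omega>. (f \<omega>)\<^sup>2) / 2))"
begin

lemma G_measurable: "f \<in> G \<Longrightarrow> random_variable borel f"
  using G_integrable by auto

lemma G_diff: "f \<in> G \<Longrightarrow> g \<in> G \<Longrightarrow> (\<lambda>\<omega>. f \<omega> - g \<omega>) \<in> G"
  using G_add[of f "\<lambda>\<omega>. (-1) * g \<omega>"] G_scale[of g "-1"] by simp

lemma G_sum: "(\<And>i. i \<in> I \<Longrightarrow> f i \<in> G) \<Longrightarrow> (\<lambda>\<omega>. \<Sum>i\<in>I. f i \<omega>) \<in> G"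
  by (induction I rule: infinite_finite_induct) (auto intro: G_zero G_add)

lemma G_integrable_mult:
  assumes "f \<in> G" "g \<in> G"
  shows "integrable M (\<lambda>\<omega>. f \<omega> * g \<omega>)"
proof (rule Bochner_Integration.integrable_bound)
  show "integrable M (\<lambda>\<omega>. (f \<omega>)\<^sup>2 + (g \<omega>)\<^sup>2)"
    using assms by (intro Bochner_Integration.integrable_add G_square_integrable)
  show "AE \<omega> in M. norm (f \<omega> * g \<omega>) \<le> norm ((f \<omega>)\<^sup>2 + (g \<omega>)\<^sup>2)" by (simp add: abs_mult_le_sum_squares)
qed (use assms G_measurable in measurable)

text \<open>By orthogonality, the variance of a multiple of \<open>Z\<close> plus a combination of
  the \<open>Y p\<close> splits. Variance determines the characteristic function here, so the latter
  factorizes and \<open>Z\<close> is independent of the \<open>Y p\<close>.\<close>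

lemma orthogonal_imp_integral_zero:
  assumes J: "finite J" and Z: "Z \<in> G" and Y: "\<And>p. p \<in> J \<Longrightarrow> Y p \<in> G"
    and orth: "\<And>p. p \<in> J \<Longrightarrow> expectation (\<lambda>\<omega>. Z \<omega> * Y p \<omega>) = 0"
    and A: "A \<in> sigma_sets (space M) {{\<omega>\<in>space M. \<forall>p\<in>J. Y p \<omega> \<in> B p} | B. \<forall>p. B p \<in> sets borel}"
  shows "expectation (\<lambda>\<omega>. indicator A \<omega> * Z \<omega>) = 0"
proof -
  have "(CLINT \<omega>|M. iexp (s * Z \<omega>) * (\<Prod>p\<in>J. iexp (t p * Y p \<omega>)))
      = (CLINT \<omega>|M. iexp (s * Z \<omega>)) * (CLINT \<omega>|M. (\<Prod>p\<in>J. iexp (t p * Y p \<omega>)))" for s t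
  proof -
    define f where "f \<omega> = (\<Sum>p\<in>J. t p * Y p \<omega>)" for \<omega>
    define g where "g \<omega> = s * Z \<omega>" for \<omega>
    have f: "f \<in> G" unfolding f_def[abs_def] by (intro G_sum G_scale Y)
    have g: "g \<in> G" unfolding g_def[abs_def] by (intro G_scale Z)
    have prod: "(\<Prod>p\<in>J. iexp (t p * Y p \<omega>)) = iexp (f \<omega>)" for \<omega>
      by (simp add: f_def exp_sum[OF J] sum_distrib_left)
    have "expectation (\<lambda>\<omega>. g \<omega> * f \<omega>) = expectation (\<lambda>\<omega>. \<Sum>p\<in>J. s * t p * (Z \<omega> * Y p \<omega>))"
      by (simp add: f_def g_def sum_distrib_left ac_simps)
    also have "\<dots> = 0"
      using orth by (subst Bochner_Integration.integral_sum)
        (auto intro!: integrable_mult_right G_integrable_mult Z Y)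
    finally have gf: "expectation (\<lambda>\<omega>. g \<omega> * f \<omega>) = 0" .
    have "expectation (\<lambda>\<omega>. (g \<omega> + f \<omega>)\<^sup>2) = expectation (\<lambda>\<omega>. (g \<omega>)\<^sup>2 + (f \<omega>)\<^sup>2 + 2 * (g \<omega> * f \<omega>))"
      by (simp add: power2_eq_square algebra_simps)
    also have "\<dots> = expectation (\<lambda>\<omega>. (g \<omega>)\<^sup>2) + expectation (\<lambda>\<omega>. (f \<omega>)\<^sup>2)"
      using gf f g G_square_integrable G_integrable_mult by simp
    finally have sq: "expectation (\<lambda>\<omega>. (g \<omega> + f \<omega>)\<^sup>2) = expectation (\<lambda>\<omega>. (g \<omega>)\<^sup>2) + expectation (\<lambda>\<omega>. (f \<omega>)\<^sup>2)" .
    have "(CLINT \<omega>|M. iexp (g \<omega>) * iexp (f \<omega>)) = (CLINT \<omega>|M. iexp (g \<omega> + f \<omega>))"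
      by (simp add: exp_add distrib_left)
    also have "\<dots> = (CLINT \<omega>|M. iexp (g \<omega>)) * (CLINT \<omega>|M. iexp (f \<omega>))"
      unfolding G_char[OF G_add[OF g f]] G_char[OF g] G_char[OF f] sq
      by (simp add: exp_add[symmetric] diff_divide_distrib flip: of_real_mult)
    finally show ?thesis by (simp only: prod g_def)
  qed
  then have "expectation (\<lambda>\<omega>. indicator A \<omega> * Z \<omega>) = prob A * expectation Z"
    using A by (intro integral_indicator_mult_indep[OF J]) (auto intro: G_measurable G_integrable Y Z)
  then show ?thesis using G_mean[OF Z] by simp
qed

end

section \<open>Random vectors, generated sigma-algebras and cross moments\<close>

lemma borel_measurable_vec_iff:
  fixes X :: "'a \<Rightarrow> real^'n::finite"
  shows "X \<in> borel_measurable M \<longleftrightarrow> (\<forall>i. (\<lambda>\<omega>. X \<omega> $ i) \<in> borel_measurable M)"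
proof
  assume "X \<in> borel_measurable M"
  moreover have "(\<lambda>x::real^'n. x $ i) \<in> borel_measurable borel" for i
    by (intro borel_measurable_continuous_onI continuous_intros)
  ultimately show "\<forall>i. (\<lambda>\<omega>. X \<omega> $ i) \<in> borel_measurable M"
    using measurable_compose by blast
next
  assume "\<forall>i. (\<lambda>\<omega>. X \<omega> $ i) \<in> borel_measurable M"
  then show "X \<in> borel_measurable M"
    unfolding borel_measurable_euclidean_space[of X M]
    by (auto simp: Basis_vec_def inner_axis)
qed

text \<open>Polarization: the form at \<open>e_i\<close> gives the diagonal, and the form at
  \<open>e_i + e_j\<close> then gives twice the common off-diagonal entry.\<close>

lemma symm_eqI:
  fixes S T :: "real^'m::finite^'m"
  assumes "symm S" "symm T" "\<And>a. a \<bullet> (S *v a) = a \<bullet> (T *v a)"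
  shows "S = T"
proof -
  have sym: "U $ j $ i = U $ i $ j" if "symm U" for U :: "real^'m^'m" and i j
    using that unfolding symm_def by (metis transpose_def vec_lambda_beta)
  have d: "S $ i $ i = T $ i $ i" for i
    using assms(3)[of "axis i 1 + 0 *\<^sub>R axis i 1"] unfolding quadratic_form_axis by simp
  have "S $ i $ j = T $ i $ j" for i j
    using assms(3)[of "axis i 1 + 1 *\<^sub>R axis j 1"] d[of i] d[of j] sym[OF assms(1), of i j] sym[OF assms(2), of i j]
    unfolding quadratic_form_axis by simp
  then show ?thesis by (simp add: vec_eq_iff)
qed

lemma space_gen_sa: "space (gen_sa M Xs) = space M"
  by (simp add: gen_sa_def space_measure_of_conv)

lemma sets_gen_sa: "sets (gen_sa M Xs) = sigma_sets (space M) {X -` B \<inter> space M |X B. X \<in> Xs \<and> B \<in> sets borel}"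
  unfolding gen_sa_def by (rule sets_measure_of) auto

lemma subalgebra_gen_sa:
  assumes "\<And>X. X \<in> Xs \<Longrightarrow> X \<in> borel_measurable M"
  shows "subalgebra M (gen_sa M Xs)"
proof -
  have "{X -` B \<inter> space M |X B. X \<in> Xs \<and> B \<in> sets borel} \<subseteq> sets M"
    using assms by (auto intro: measurable_sets)
  then show ?thesis
    unfolding subalgebra_def space_gen_sa sets_gen_sa using sets.sigma_sets_subset by blast
qed

lemma measurable_gen_sa:
  assumes "X \<in> Xs"
  shows "X \<in> borel_measurable (gen_sa M Xs)"
proof (rule measurableI)
  fix B :: "(real^'b) set" assume "B \<in> sets borel"
  with assms show "X -` B \<inter> space (gen_sa M Xs) \<in> sets (gen_sa M Xs)"
    unfolding space_gen_sa sets_gen_sa by (intro sigma_sets.Basic) blast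
qed simp

lemma subalgebra_gen_sa_mono: "Xs \<subseteq> Ys \<Longrightarrow> subalgebra (gen_sa M Ys) (gen_sa M Xs)"
  unfolding subalgebra_def space_gen_sa sets_gen_sa by (intro conjI refl sigma_sets_mono') blast

text \<open>Passes from preimages of Borel sets of vectors to boxes in the scalar components,
  indexed by pairs of vector and coordinate, the generator for which orthogonality was
  exploited.\<close>

lemma sets_gen_sa_subset:
  fixes Xs :: "('a \<Rightarrow> real^'n::finite) set"
  shows "sets (gen_sa M Xs) \<subseteq> sigma_sets (space M)
    {{\<omega>\<in>space M. \<forall>p\<in>Xs \<times> UNIV. fst p \<omega> $ snd p \<in> B p} | B. \<forall>p. B p \<in> sets borel}"
    (is "_ \<subseteq> sigma_sets _ ?E")
proof -
  have EP: "?E \<subseteq> Pow (space M)" by auto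
  let ?F = "sigma (space M) ?E"
  have sp: "space ?F = space M" by (simp add: space_measure_of_conv)
  have "X \<in> borel_measurable ?F" if X: "X \<in> Xs" for X
    unfolding borel_measurable_vec_iff
  proof (intro allI measurableI)
    fix i and b :: "real set" assume b: "b \<in> sets borel"
    have "(\<lambda>\<omega>. X \<omega> $ i) -` b \<inter> space ?F \<in> ?E"
      unfolding sp using X b
      by (intro CollectI exI[of _ "\<lambda>p. if p = (X, i) then b else UNIV"]) auto
    then show "(\<lambda>\<omega>. X \<omega> $ i) -` b \<inter> space ?F \<in> sets ?F"
      using EP by (simp only: sets_measure_of sigma_sets.Basic)
  qed simp
  then have "{X -` B \<inter> space M |X B. X \<in> Xs \<and> B \<in> sets borel} \<subseteq> sets ?F"
    using measurable_sets[of _ ?F borel] unfolding sp by blast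
  then have "sigma_sets (space M) {X -` B \<inter> space M |X B. X \<in> Xs \<and> B \<in> sets borel} \<subseteq> sets ?F"
    using sets.sigma_sets_subset[of _ ?F] unfolding sp by blast
  then show ?thesis
    using EP unfolding sets_gen_sa by (simp only: sets_measure_of)
qed

text \<open>The matrix E X Y', a cross-covariance for centred vectors; its bilinearity carries the
  filtering computation.\<close>

definition cross :: "'w measure \<Rightarrow> ('w \<Rightarrow> real^'m) \<Rightarrow> ('w \<Rightarrow> real^'m) \<Rightarrow> real^'m^'m" where
  "cross M X Y = (\<chi> i j. integral\<^sup>L M (\<lambda>\<omega>. X \<omega> $ i * Y \<omega> $ j))"

lemma smom_eq_cross: "smom M X = cross M X X"
  by (simp add: smom_def cross_def)

lemma cross_transpose: "transpose (cross M X Y) = cross M Y X"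
  by (simp add: cross_def transpose_def vec_eq_iff mult.commute)

lemma symm_smom: "symm (smom M X)"
  by (simp add: symm_def smom_eq_cross cross_transpose)

context gaussian_space
begin

definition GV :: "('a \<Rightarrow> real^'n::finite) set" where
  "GV = {X. \<forall>i. (\<lambda>\<omega>. X \<omega> $ i) \<in> G}"

lemma GV_measurable: "X \<in> GV \<Longrightarrow> X \<in> borel_measurable M"
  by (simp add: GV_def borel_measurable_vec_iff G_measurable)

lemma GV_zero: "(\<lambda>_. 0) \<in> GV"
  by (simp add: GV_def G_zero)

lemma GV_add: "X \<in> GV \<Longrightarrow> Y \<in> GV \<Longrightarrow> (\<lambda>\<omega>. X \<omega> + Y \<omega>) \<in> GV"
  by (simp add: GV_def G_add)

lemma GV_diff: "X \<in> GV \<Longrightarrow> Y \<in> GV \<Longrightarrow> (\<lambda>\<omega>. X \<omega> - Y \<omega>) \<in> GV"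
  by (simp add: GV_def G_diff)

lemma GV_sum: "(\<And>i. i \<in> I \<Longrightarrow> X i \<in> GV) \<Longrightarrow> (\<lambda>\<omega>. \<Sum>i\<in>I. X i \<omega>) \<in> GV"
  by (simp add: GV_def G_sum)

lemma GV_mult: "X \<in> GV \<Longrightarrow> (\<lambda>\<omega>. L *v X \<omega>) \<in> GV"
  by (simp add: GV_def matrix_vector_mult_def G_sum G_scale)

lemma GV_inner: "X \<in> GV \<Longrightarrow> (\<lambda>\<omega>. a \<bullet> X \<omega>) \<in> G"
  by (simp add: GV_def inner_vec_def G_sum G_scale)

lemma GV_integrable_mult: "X \<in> GV \<Longrightarrow> Y \<in> GV \<Longrightarrow> integrable M (\<lambda>\<omega>. X \<omega> $ i * Y \<omega> $ j)"
  by (simp add: GV_def G_integrable_mult)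

lemma cross_add_left: "X \<in> GV \<Longrightarrow> X' \<in> GV \<Longrightarrow> Y \<in> GV \<Longrightarrow>
    cross M (\<lambda>\<omega>. X \<omega> + X' \<omega>) Y = cross M X Y + cross M X' Y"
  by (simp add: cross_def vec_eq_iff distrib_right GV_integrable_mult)

lemma cross_diff_left: "X \<in> GV \<Longrightarrow> X' \<in> GV \<Longrightarrow> Y \<in> GV \<Longrightarrow>
    cross M (\<lambda>\<omega>. X \<omega> - X' \<omega>) Y = cross M X Y - cross M X' Y"
  by (simp add: cross_def vec_eq_iff left_diff_distrib GV_integrable_mult)

lemma cross_mult_left: "X \<in> GV \<Longrightarrow> Y \<in> GV \<Longrightarrow>
    cross M (\<lambda>\<omega>. L *v X \<omega>) Y = L ** cross M X Y"
  by (simp add: cross_def vec_eq_iff matrix_vector_mult_def matrix_matrix_mult_def sum_distrib_right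
      mult.assoc GV_integrable_mult)

lemma cross_add_right: "X \<in> GV \<Longrightarrow> Y \<in> GV \<Longrightarrow> Y' \<in> GV \<Longrightarrow>
    cross M X (\<lambda>\<omega>. Y \<omega> + Y' \<omega>) = cross M X Y + cross M X Y'"
  by (simp add: cross_def vec_eq_iff distrib_left GV_integrable_mult)

lemma cross_diff_right: "X \<in> GV \<Longrightarrow> Y \<in> GV \<Longrightarrow> Y' \<in> GV \<Longrightarrow>
    cross M X (\<lambda>\<omega>. Y \<omega> - Y' \<omega>) = cross M X Y - cross M X Y'"
  by (simp add: cross_def vec_eq_iff right_diff_distrib GV_integrable_mult)

lemma cross_mult_right: "X \<in> GV \<Longrightarrow> Y \<in> GV \<Longrightarrow>
    cross M X (\<lambda>\<omega>. L *v Y \<omega>) = cross M X Y ** transpose L"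
  by (metis cross_mult_left cross_transpose matrix_transpose_mul)

lemma cross_sum_right: "X \<in> GV \<Longrightarrow> (\<And>i. i \<in> I \<Longrightarrow> Y i \<in> GV) \<Longrightarrow>
    cross M X (\<lambda>\<omega>. \<Sum>i\<in>I. Y i \<omega>) = (\<Sum>i\<in>I. cross M X (Y i))"
  by (simp add: cross_def vec_eq_iff sum_distrib_left GV_integrable_mult)

lemma cross_zero_right: "cross M X (\<lambda>_. 0) = 0"
  by (simp add: cross_def vec_eq_iff)

text \<open>In a Gaussian space conditional expectation is orthogonal projection: the error
  \<open>f - g\<close> is uncorrelated with the generators, so it integrates to zero over every
  event they generate.\<close>

lemma cond_exp_eq_of_orthogonal:
  fixes Xs :: "('a \<Rightarrow> real^'n::finite) set" and f g :: "'a \<Rightarrow> real"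
  assumes Xs: "finite Xs" "Xs \<subseteq> GV" and f: "f \<in> G" and g: "g \<in> G"
    and gm: "g \<in> borel_measurable (gen_sa M Xs)"
    and orth: "\<And>X i. X \<in> Xs \<Longrightarrow> expectation (\<lambda>\<omega>. (f \<omega> - g \<omega>) * X \<omega> $ i) = 0"
  shows "AE \<omega> in M. real_cond_exp M (gen_sa M Xs) f \<omega> = g \<omega>"
proof -
  have sub: "subalgebra M (gen_sa M Xs)"
    using Xs GV_measurable by (intro subalgebra_gen_sa) auto
  then interpret finite_measure_subalgebra M "gen_sa M Xs" by unfold_locales
  have fg: "(\<lambda>\<omega>. f \<omega> - g \<omega>) \<in> G" using f g by (rule G_diff)
  show ?thesis
  proof (rule real_cond_exp_charact)
    fix A assume A: "A \<in> sets (gen_sa M Xs)"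
    then have Am[measurable]: "A \<in> events" using sub unfolding subalgebra_def by blast
    have "expectation (\<lambda>\<omega>. indicator A \<omega> * (f \<omega> - g \<omega>)) = 0"
    proof (rule orthogonal_imp_integral_zero[OF _ fg])
      show "A \<in> sigma_sets (space M)
          {{\<omega>\<in>space M. \<forall>p\<in>Xs \<times> UNIV. (\<lambda>(X, i) \<omega>. X \<omega> $ i) p \<omega> \<in> B p} | B. \<forall>p. B p \<in> sets borel}"
        using A sets_gen_sa_subset[of M Xs] by (auto simp: case_prod_unfold)
    qed (use Xs orth in \<open>auto simp: GV_def subset_iff\<close>)
    moreover have "integrable M (\<lambda>\<omega>. indicator A \<omega> * h \<omega>)" if "h \<in> G" for h
      using integrable_mult_indicator[OF Am G_integrable[OF that]] by simp
    ultimately show "set_lebesgue_integral M A f = set_lebesgue_integral M A g"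
      using f g by (simp add: set_lebesgue_integral_def right_diff_distrib)
  qed (use f g gm in \<open>auto intro: G_integrable\<close>)
qed

lemma orthogonal_of_cross_zero:
  assumes "cross M X Y = 0"
  shows "expectation (\<lambda>\<omega>. X \<omega> $ i * Y \<omega> $ j) = 0"
  using assms unfolding cross_def vec_eq_iff by simp

end

section \<open>Gaussian vectors and linear combinations of independent ones\<close>

context prob_space
begin

lemma inner_matrix_smom:
  fixes X :: "'a \<Rightarrow> real^'n::finite"
  assumes m: "\<And>i. random_variable borel (\<lambda>\<omega>. X \<omega> $ i)" and sq: "\<And>i. integrable M (\<lambda>\<omega>. (X \<omega> $ i)\<^sup>2)"
  shows "integrable M (\<lambda>\<omega>. (a \<bullet> X \<omega>)\<^sup>2)" "a \<bullet> (smom M X *v a) = expectation (\<lambda>\<omega>. (a \<bullet> X \<omega>)\<^sup>2)"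
proof -
  have i: "integrable M (\<lambda>\<omega>. X \<omega> $ i * X \<omega> $ j)" for i j
  proof (rule Bochner_Integration.integrable_bound)
    show "integrable M (\<lambda>\<omega>. (X \<omega> $ i)\<^sup>2 + (X \<omega> $ j)\<^sup>2)" using sq by simp
    show "AE \<omega> in M. norm (X \<omega> $ i * X \<omega> $ j) \<le> norm ((X \<omega> $ i)\<^sup>2 + (X \<omega> $ j)\<^sup>2)" by (simp add: abs_mult_le_sum_squares)
  qed (use m in simp)
  have e: "(a \<bullet> X \<omega>)\<^sup>2 = (\<Sum>i\<in>UNIV. \<Sum>j\<in>UNIV. a $ i * a $ j * (X \<omega> $ i * X \<omega> $ j))" for \<omega>
    by (simp add: inner_vec_def power2_eq_square sum_product ac_simps)
  show "integrable M (\<lambda>\<omega>. (a \<bullet> X \<omega>)\<^sup>2)"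
    unfolding e using i by (intro Bochner_Integration.integrable_sum integrable_mult_right)
  show "a \<bullet> (smom M X *v a) = expectation (\<lambda>\<omega>. (a \<bullet> X \<omega>)\<^sup>2)"
    unfolding e using i by (simp add: quadratic_form_entries smom_def ac_simps)
qed

lemma gaussian_vec_inner:
  fixes X :: "'a \<Rightarrow> real^'n::finite"
  assumes X: "gaussian_vec M X V" and V: "0 \<le> a \<bullet> (V *v a)"
  shows "integrable M (\<lambda>\<omega>. a \<bullet> X \<omega>)" (is ?A)
    and "expectation (\<lambda>\<omega>. a \<bullet> X \<omega>) = 0" (is ?B)
    and "integrable M (\<lambda>\<omega>. (a \<bullet> X \<omega>)\<^sup>2)" (is ?C)
    and "expectation (\<lambda>\<omega>. (a \<bullet> X \<omega>)\<^sup>2) = a \<bullet> (V *v a)" (is ?D)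
    and "(CLINT \<omega>|M. iexp (a \<bullet> X \<omega>)) = of_real (exp (- (a \<bullet> (V *v a)) / 2))" (is ?E)
proof -
  define v where "v = a \<bullet> (V *v a)"
  define Y where "Y \<omega> = a \<bullet> X \<omega>" for \<omega>
  have "random_variable borel X" using X by (simp add: gaussian_vec_def)
  then have Ym[measurable]: "random_variable borel Y" unfolding Y_def[abs_def] by simp
  have dist: "distr M borel Y = (if v = 0 then return borel 0 else density lborel (normal_density 0 (sqrt v)))"
    using X by (simp add: gaussian_vec_def v_def Y_def[abs_def])
  have "integrable M Y \<and> expectation Y = 0 \<and> integrable M (\<lambda>\<omega>. (Y \<omega>)\<^sup>2) \<and> expectation (\<lambda>\<omega>. (Y \<omega>)\<^sup>2) = v
    \<and> (CLINT \<omega>|M. iexp (Y \<omega>)) = of_real (exp (- v / 2))"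
  proof (cases "v = 0")
    case True
    have "AE y in return borel (0::real). y = 0" by (simp add: AE_return)
    then have "AE y in distr M borel Y. y = 0" unfolding dist using True by simp
    then have ae: "AE \<omega> in M. Y \<omega> = 0" by (simp add: AE_distr_iff)
    have "integrable M f \<and> integral\<^sup>L M f = c" if "AE \<omega> in M. f \<omega> = c" "f \<in> borel_measurable M"
      for f :: "'a \<Rightarrow> 'c::{banach, second_countable_topology}" and c
    proof -
      have "integrable M f \<longleftrightarrow> integrable M (\<lambda>_. c)" by (rule integrable_cong_AE) (use that in auto)
      moreover have "integral\<^sup>L M f = integral\<^sup>L M (\<lambda>_. c)" by (rule integral_cong_AE) (use that in auto)
      ultimately show ?thesis by (simp add: prob_space)
    qed note const = this
    show ?thesis
    proof -
      have "AE \<omega> in M. (Y \<omega>)\<^sup>2 = 0" "AE \<omega> in M. iexp (Y \<omega>) = 1"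
        using ae by (eventually_elim, simp)+
      with const[of Y 0] const[of "\<lambda>\<omega>. (Y \<omega>)\<^sup>2" 0] const[of "\<lambda>\<omega>. iexp (Y \<omega>)" 1] ae True
      show ?thesis by simp
    qed
  next
    case False
    then have pos: "0 < sqrt v" using V by (simp add: v_def)
    then have v: "(sqrt v)\<^sup>2 = v" by simp
    have D: "distributed M lborel Y (normal_density 0 (sqrt v))"
    proof -
      have "distr M lborel Y = distr M borel Y" by (rule distr_cong) auto
      then show ?thesis using False dist by (simp add: distributed_def)
    qed
    have i1: "integrable M Y"
      using distributed_integrable[OF D, of "\<lambda>x. x"] integrable_normal_moment_nz_1[OF pos, of 0] by simp
    have i2: "integrable M (\<lambda>\<omega>. (Y \<omega>)\<^sup>2)"
      using distributed_integrable[OF D, of "\<lambda>x. x\<^sup>2"] integrable_normal_moment[OF pos, of 0 2] by simp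
    have e1: "expectation Y = 0" using normal_distributed_expectation[OF pos D] .
    have e2: "expectation (\<lambda>\<omega>. (Y \<omega>)\<^sup>2) = v"
      using normal_distributed_variance[OF pos D] e1 v by simp
    \<comment> \<open>Dividing by \<open>sqrt v\<close> gives a standard normal, whose
      characteristic function at \<open>sqrt v\<close> is the value wanted.\<close>
    have "distr M borel (\<lambda>\<omega>. Y \<omega> / sqrt v) = std_normal_distribution"
    proof -
      have "distributed M lborel (\<lambda>\<omega>. Y \<omega> / sqrt v) std_normal_density"
        using normal_standard_normal_convert[OF pos, of Y 0] D by simp
      moreover have "distr M lborel (\<lambda>\<omega>. Y \<omega> / sqrt v) = distr M borel (\<lambda>\<omega>. Y \<omega> / sqrt v)"
        by (rule distr_cong) auto
      ultimately show ?thesis by (simp add: distributed_def)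
    qed
    then have "char (distr M borel (\<lambda>\<omega>. Y \<omega> / sqrt v)) (sqrt v) = of_real (exp (- v / 2))"
      using v by (simp add: char_std_normal_distribution)
    moreover have "char (distr M borel (\<lambda>\<omega>. Y \<omega> / sqrt v)) (sqrt v) = (CLINT \<omega>|M. iexp (sqrt v * (Y \<omega> / sqrt v)))"
      unfolding char_def by (rule integral_distr) measurable
    moreover have "sqrt v * (Y \<omega> / sqrt v) = Y \<omega>" for \<omega> using pos by simp
    ultimately have "(CLINT \<omega>|M. iexp (Y \<omega>)) = of_real (exp (- v / 2))"
      by (simp only:)
    then show ?thesis using i1 i2 e1 e2 by blast
  qed
  then show ?A ?B ?C ?D ?E unfolding Y_def[abs_def] v_def by auto
qed

context
  fixes I :: "'i set" and X :: "'i \<Rightarrow> 'a \<Rightarrow> real^'n::finite" and V :: "'i \<Rightarrow> real^'n^'n"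
  assumes I: "finite I" and indep: "indep_vars (\<lambda>_. borel) X I"
    and X: "\<And>i. i \<in> I \<Longrightarrow> gaussian_vec M (X i) (V i)" and V: "\<And>i. i \<in> I \<Longrightarrow> psd (V i)"
begin

private lemma V': "i \<in> I \<Longrightarrow> 0 \<le> a \<bullet> (V i *v a)"
  using V unfolding psd_def by blast

lemma integrable_inner: "i \<in> I \<Longrightarrow> integrable M (\<lambda>\<omega>. a \<bullet> X i \<omega>)"
  by (rule gaussian_vec_inner(1)[OF X V'])

lemma indep_gaussian_inner_product:
  assumes "i \<in> I" "j \<in> I" "i \<noteq> j"
  shows "integrable M (\<lambda>\<omega>. (a \<bullet> X i \<omega>) * (b \<bullet> X j \<omega>))" "expectation (\<lambda>\<omega>. (a \<bullet> X i \<omega>) * (b \<bullet> X j \<omega>)) = 0"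
proof -
  define Y where "Y k \<omega> = (if k = i then a else b) \<bullet> X k \<omega>" for k \<omega>
  have "indep_vars (\<lambda>_. borel) X {i, j}"
    by (rule indep_vars_subset[OF indep]) (use assms in simp)
  then have ind: "indep_vars (\<lambda>_. borel) Y {i, j}"
    unfolding Y_def[abs_def] by (rule indep_vars_compose2) simp
  have int: "integrable M (Y k)" if "k \<in> {i, j}" for k
    unfolding Y_def[abs_def] by (rule integrable_inner) (use that assms in blast)
  have fin: "finite {i, j}" by simp
  have prod: "(\<Prod>k\<in>{i, j}. Y k \<omega>) = (a \<bullet> X i \<omega>) * (b \<bullet> X j \<omega>)" for \<omega>
    using assms(3) by (simp add: Y_def)
  show "integrable M (\<lambda>\<omega>. (a \<bullet> X i \<omega>) * (b \<bullet> X j \<omega>))"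
    using indep_vars_integrable[OF fin ind int] unfolding prod .
  have "expectation (\<lambda>\<omega>. (a \<bullet> X i \<omega>) * (b \<bullet> X j \<omega>)) = (\<Prod>k\<in>{i, j}. expectation (Y k))"
    using indep_vars_lebesgue_integral[OF fin ind int] unfolding prod .
  moreover have "expectation (Y i) = 0"
    unfolding Y_def[abs_def] by (rule gaussian_vec_inner(2)[OF X[OF assms(1)] V'[OF assms(1)]])
  ultimately show "expectation (\<lambda>\<omega>. (a \<bullet> X i \<omega>) * (b \<bullet> X j \<omega>)) = 0"
    using assms(3) by simp
qed

text \<open>Independence enters twice: it removes the mixed products from the second moment and
  factorizes the characteristic function. Both are then governed by the sum of the forms
  \<open>a i \<bullet> (V i *v a i)\<close>.\<close>

lemma gaussian_space_span: "gaussian_space M {f. \<exists>a. f = (\<lambda>\<omega>. \<Sum>i\<in>I. a i \<bullet> X i \<omega>)}"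
proof
  let ?G = "{f. \<exists>a. f = (\<lambda>\<omega>. \<Sum>i\<in>I. a i \<bullet> X i \<omega>)}"
  show "(\<lambda>_. 0) \<in> ?G" by (auto intro: exI[of _ "\<lambda>_. 0"])
  show "(\<lambda>\<omega>. f \<omega> + g \<omega>) \<in> ?G" if "f \<in> ?G" "g \<in> ?G" for f g
  proof -
    obtain a b where "f = (\<lambda>\<omega>. \<Sum>i\<in>I. a i \<bullet> X i \<omega>)" "g = (\<lambda>\<omega>. \<Sum>i\<in>I. b i \<bullet> X i \<omega>)"
      using \<open>f \<in> ?G\<close> \<open>g \<in> ?G\<close> by blast
    then show ?thesis
      by (intro CollectI exI[of _ "\<lambda>i. a i + b i"]) (simp add: inner_add_left sum.distrib)
  qed
  show "(\<lambda>\<omega>. c * f \<omega>) \<in> ?G" if "f \<in> ?G" for f c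
  proof -
    obtain a where "f = (\<lambda>\<omega>. \<Sum>i\<in>I. a i \<bullet> X i \<omega>)" using \<open>f \<in> ?G\<close> by blast
    then show ?thesis
      by (intro CollectI exI[of _ "\<lambda>i. c *\<^sub>R a i"]) (simp add: sum_distrib_left)
  qed
  fix f assume "f \<in> ?G"
  then obtain a where f: "f = (\<lambda>\<omega>. \<Sum>i\<in>I. a i \<bullet> X i \<omega>)" by blast
  have mean: "expectation (\<lambda>\<omega>. a \<bullet> X i \<omega>) = 0" if "i \<in> I" for a i
    by (rule gaussian_vec_inner(2)[OF X[OF that] V'[OF that]])
  have sqi: "integrable M (\<lambda>\<omega>. (a \<bullet> X i \<omega>)\<^sup>2)" if "i \<in> I" for a i
    by (rule gaussian_vec_inner(3)[OF X[OF that] V'[OF that]])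
  have sqe: "expectation (\<lambda>\<omega>. (a \<bullet> X i \<omega>)\<^sup>2) = a \<bullet> (V i *v a)" if "i \<in> I" for a i
    by (rule gaussian_vec_inner(4)[OF X[OF that] V'[OF that]])
  have ch: "(CLINT \<omega>|M. iexp (a \<bullet> X i \<omega>)) = of_real (exp (- (a \<bullet> (V i *v a)) / 2))" if "i \<in> I" for a i
    by (rule gaussian_vec_inner(5)[OF X[OF that] V'[OF that]])
  show "integrable M f"
    unfolding f by (intro Bochner_Integration.integrable_sum integrable_inner)
  show "expectation f = 0"
    unfolding f by (subst Bochner_Integration.integral_sum) (simp_all add: integrable_inner mean)
  have sq: "(f \<omega>)\<^sup>2 = (\<Sum>i\<in>I. \<Sum>j\<in>I. (a i \<bullet> X i \<omega>) * (a j \<bullet> X j \<omega>))" for \<omega>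
    by (simp add: f power2_eq_square sum_product)
  have int: "integrable M (\<lambda>\<omega>. (a i \<bullet> X i \<omega>) * (a j \<bullet> X j \<omega>))" if "i \<in> I" "j \<in> I" for i j
    using indep_gaussian_inner_product(1)[OF that, of "a i" "a j"] sqi[OF that(1), of "a i"]
    by (cases "i = j") (simp_all add: power2_eq_square)
  show "integrable M (\<lambda>\<omega>. (f \<omega>)\<^sup>2)"
    unfolding sq by (intro Bochner_Integration.integrable_sum int)
  have "expectation (\<lambda>\<omega>. (f \<omega>)\<^sup>2) = (\<Sum>i\<in>I. \<Sum>j\<in>I. expectation (\<lambda>\<omega>. (a i \<bullet> X i \<omega>) * (a j \<bullet> X j \<omega>)))"
    unfolding sq by (simp add: int Bochner_Integration.integral_sum)
  also have "\<dots> = (\<Sum>i\<in>I. \<Sum>j\<in>I. if i = j then a i \<bullet> (V i *v a i) else 0)"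
  proof (intro sum.cong refl)
    fix i j assume ij: "i \<in> I" "j \<in> I"
    show "expectation (\<lambda>\<omega>. (a i \<bullet> X i \<omega>) * (a j \<bullet> X j \<omega>)) = (if i = j then a i \<bullet> (V i *v a i) else 0)"
      using indep_gaussian_inner_product(2)[OF ij, of "a i" "a j"] sqe[OF ij(1), of "a i"]
      by (cases "i = j") (simp_all add: power2_eq_square)
  qed
  also have "\<dots> = (\<Sum>i\<in>I. a i \<bullet> (V i *v a i))"
    using I by simp
  finally have var: "expectation (\<lambda>\<omega>. (f \<omega>)\<^sup>2) = (\<Sum>i\<in>I. a i \<bullet> (V i *v a i))" .
  have "(CLINT \<omega>|M. iexp (f \<omega>)) = (CLINT \<omega>|M. \<Prod>i\<in>I. iexp (a i \<bullet> X i \<omega>))"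
    by (simp add: f sum_distrib_left exp_sum[OF I])
  also have "\<dots> = (\<Prod>i\<in>I. CLINT \<omega>|M. iexp (a i \<bullet> X i \<omega>))"
  proof (rule indep_vars_lebesgue_integral[OF I])
    show "indep_vars (\<lambda>_. borel) (\<lambda>i \<omega>. iexp (a i \<bullet> X i \<omega>)) I"
      using indep by (rule indep_vars_compose2) simp
    show "integrable M (\<lambda>\<omega>. iexp (a i \<bullet> X i \<omega>))" if "i \<in> I" for i
    proof -
      have [measurable]: "random_variable borel (X i)" using X[OF that] by (simp add: gaussian_vec_def)
      show ?thesis by (intro integrable_const_bound[where B = 1]) auto
    qed
  qed
  also have "\<dots> = of_real (exp (\<Sum>i\<in>I. - (a i \<bullet> (V i *v a i)) / 2))"
    by (simp add: ch exp_sum[OF I])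
  also have "(\<Sum>i\<in>I. - (a i \<bullet> (V i *v a i)) / 2) = - expectation (\<lambda>\<omega>. (f \<omega>)\<^sup>2) / 2"
    by (simp add: var sum_negf flip: sum_divide_distrib)
  finally show "(CLINT \<omega>|M. iexp (f \<omega>)) = of_real (exp (- expectation (\<lambda>\<omega>. (f \<omega>)\<^sup>2) / 2))" .
qed

lemma cross_indep_gaussian:
  assumes "i \<in> I" "j \<in> I" "i \<noteq> j"
  shows "cross M (X i) (X j) = 0"
  using indep_gaussian_inner_product(2)[OF assms, of "axis _ 1" "axis _ 1"]
  by (simp add: cross_def vec_eq_iff inner_axis')

lemma smom_gaussian:
  assumes "i \<in> I"
  shows "smom M (X i) = V i"
proof (rule symm_eqI)
  note g = gaussian_vec_inner[OF X[OF assms] V'[OF assms]]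
  show "symm (smom M (X i))" by (rule symm_smom)
  show "symm (V i)" using V[OF assms] by (simp add: psd_def)
  show "a \<bullet> (smom M (X i) *v a) = a \<bullet> (V i *v a)" for a
    using inner_matrix_smom(2)[of "X i" a] g(4)[of a] g(1)[of "axis _ 1"] g(3)[of "axis _ 1"]
    by (auto simp: inner_axis')
qed

lemma span_member:
  assumes "i \<in> I"
  shows "(\<lambda>\<omega>. X i \<omega> $ k) \<in> {f. \<exists>a. f = (\<lambda>\<omega>. \<Sum>i\<in>I. a i \<bullet> X i \<omega>)}"
proof -
  have "(\<Sum>j\<in>I. (if j = i then axis k 1 else 0) \<bullet> X j \<omega>) = X i \<omega> $ k" for \<omega>
  proof -
    have "(\<Sum>j\<in>I. (if j = i then axis k 1 else 0) \<bullet> X j \<omega>) = (\<Sum>j\<in>I. if j = i then axis k 1 \<bullet> X i \<omega> else 0)"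
      by (rule sum.cong) auto
    then show ?thesis using I assms by (simp add: inner_axis')
  qed
  then show ?thesis
    by (intro CollectI exI[of _ "\<lambda>j. if j = i then axis k 1 else 0"]) auto
qed

end

text \<open>Conditional Jensen for the square; the source of both Loewner bounds on the estimate
  covariances.\<close>

lemma cond_exp_square_le:
  fixes f :: "'a \<Rightarrow> real"
  assumes sub: "subalgebra M F" and f[measurable]: "random_variable borel f" and sq: "integrable M (\<lambda>\<omega>. (f \<omega>)\<^sup>2)"
  shows "integrable M (\<lambda>\<omega>. (real_cond_exp M F f \<omega>)\<^sup>2)"
    and "expectation (\<lambda>\<omega>. (real_cond_exp M F f \<omega>)\<^sup>2) \<le> expectation (\<lambda>\<omega>. (f \<omega>)\<^sup>2)"
proof -
  interpret finite_measure_subalgebra M F using sub by unfold_locales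
  have fi: "integrable M f" by (rule square_integrable_imp_integrable[OF f sq])
  have q: "convex_on UNIV (\<lambda>x::real. x\<^sup>2)" by (rule convex_power2)
  show int: "integrable M (\<lambda>\<omega>. (real_cond_exp M F f \<omega>)\<^sup>2)"
    by (rule integrable_convex_cond_exp[OF fi _ _ sq q]) auto
  have "AE \<omega> in M. (real_cond_exp M F f \<omega>)\<^sup>2 \<le> real_cond_exp M F (\<lambda>\<omega>. (f \<omega>)\<^sup>2) \<omega>"
    by (rule real_cond_exp_jensens_inequality(2)[OF fi _ _ sq q]) auto
  then have "expectation (\<lambda>\<omega>. (real_cond_exp M F f \<omega>)\<^sup>2) \<le> expectation (real_cond_exp M F (\<lambda>\<omega>. (f \<omega>)\<^sup>2))"
    using int real_cond_exp_int(1)[OF sq] by (intro integral_mono_AE)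
  then show "expectation (\<lambda>\<omega>. (real_cond_exp M F f \<omega>)\<^sup>2) \<le> expectation (\<lambda>\<omega>. (f \<omega>)\<^sup>2)"
    using real_cond_exp_int(2)[OF sq] by simp
qed

end

lemma measurable_matrix_vector_mult:
  fixes X :: "'a \<Rightarrow> real^'n::finite"
  assumes "X \<in> borel_measurable M"
  shows "(\<lambda>\<omega>. L *v X \<omega>) \<in> borel_measurable M"
  using assms unfolding borel_measurable_vec_iff matrix_vector_mult_def
  by (auto intro!: borel_measurable_sum borel_measurable_times)

lemma symm_diff: "symm S \<Longrightarrow> symm T \<Longrightarrow> symm (S - T)"
  by (simp add: symm_def transpose_def vec_eq_iff)

lemma symm_congruence: "symm S \<Longrightarrow> symm (A ** S ** transpose A)"
  for S :: "real^'m::finite^'m"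
  by (simp add: symm_def matrix_transpose_mul matrix_mul_assoc)

lemma inner_congruence:
  fixes S :: "real^'m::finite^'m"
  shows "a \<bullet> ((A ** S ** transpose A) *v a) = (transpose A *v a) \<bullet> (S *v (transpose A *v a))"
  by (simp add: dot_lmul_matrix flip: matrix_vector_mul_assoc)

section \<open>Signaling rules\<close>

lemma xo_Suc: "1 \<le> k \<Longrightarrow> xo A x1 w (Suc k) = (\<lambda>\<omega>. A *v xo A x1 w k \<omega> + w k \<omega>)"
  by (cases k) auto

text \<open>The estimate of the state at time \<open>k\<close> for the signals \<open>g\<^sub>k x\<^sub>k + \<theta>\<^sub>k\<close>; starting from \<open>0\<close>
  at time \<open>0\<close> makes \<open>x\<^sub>1\<close> itself the first innovation.\<close>
fun xhat :: "real^'m::finite^'m \<Rightarrow> ('w \<Rightarrow> real^'m) \<Rightarrow> (nat \<Rightarrow> 'w \<Rightarrow> real^'m) \<Rightarrow> (nat \<Rightarrow> 'w \<Rightarrow> real^'m)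
    \<Rightarrow> (nat \<Rightarrow> real^'m^'m) \<Rightarrow> nat \<Rightarrow> 'w \<Rightarrow> real^'m" where
  "xhat A x1 w th g 0 = (\<lambda>_. 0)"
| "xhat A x1 w th g (Suc k) = (\<lambda>\<omega>. A *v xhat A x1 w th g k \<omega>
      + (g (Suc k) *v (xo A x1 w (Suc k) \<omega> - A *v xhat A x1 w th g k \<omega>) + th (Suc k) \<omega>))"

text \<open>Fixing the noise \<open>th\<close> makes all signals linear in one finite family of
  independent Gaussian primitives, with only the coefficients \<open>L\<close> left free. The
  theorem instantiates the model for the noise of each rule considered.\<close>

locale lqg_model = prob_space M for M :: "'w measure" +
  fixes \<kappa> :: nat and A Sig1 Sigw :: "real^'m::finite^'m"
    and x1 :: "'w \<Rightarrow> real^'m" and w th :: "nat \<Rightarrow> 'w \<Rightarrow> real^'m" and Th :: "nat \<Rightarrow> real^'m^'m"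
  assumes Sig1: "psd Sig1" and Sigw: "psd Sigw"
    and x1: "gaussian_vec M x1 Sig1"
    and w: "\<And>k. k \<in> {1..\<kappa>} \<Longrightarrow> gaussian_vec M (w k) Sigw"
    and noise: "noise_ok M \<kappa> x1 w th Th"
begin

definition prim_cov :: "(nat + nat) option \<Rightarrow> real^'m^'m" where
  "prim_cov i = (case i of None \<Rightarrow> Sig1 | Some (Inl k) \<Rightarrow> Sigw | Some (Inr k) \<Rightarrow> Th k)"

definition prim_span :: "('w \<Rightarrow> real) set" where
  "prim_span = {f. \<exists>a. f = (\<lambda>\<omega>. \<Sum>i\<in>prim_idx \<kappa>. a i \<bullet> prim x1 w th i \<omega>)}"

lemma prim_assms:
  shows "finite (prim_idx \<kappa>)" "indep_vars (\<lambda>_. borel) (prim x1 w th) (prim_idx \<kappa>)"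
    "\<And>i. i \<in> prim_idx \<kappa> \<Longrightarrow> gaussian_vec M (prim x1 w th i) (prim_cov i)"
    "\<And>i. i \<in> prim_idx \<kappa> \<Longrightarrow> psd (prim_cov i)"
  using noise x1 w Sig1 Sigw by (auto simp: prim_idx_def noise_ok_def prim_def prim_cov_def)

sublocale gaussian_space M prim_span
  unfolding prim_span_def by (rule gaussian_space_span[OF prim_assms])

lemma prim_GV:
  assumes "i \<in> prim_idx \<kappa>"
  shows "prim x1 w th i \<in> GV"
proof -
  have "(\<lambda>\<omega>. prim x1 w th i \<omega> $ k) \<in> prim_span" for k
    unfolding prim_span_def by (rule span_member[OF prim_assms]) (use assms in auto)
  then show ?thesis by (simp add: GV_def)
qed

lemma prim_idx_simps [simp]: "None \<in> prim_idx \<kappa>" "Some (Inl k) \<in> prim_idx \<kappa> \<longleftrightarrow> k \<in> {1..\<kappa>}"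
  "Some (Inr k) \<in> prim_idx \<kappa> \<longleftrightarrow> k \<in> {1..\<kappa>}"
  by (auto simp: prim_idx_def)

lemma x1_GV: "x1 \<in> GV"
  using prim_GV[of None] by (simp add: prim_def)

lemma w_GV: "k \<in> {1..\<kappa>} \<Longrightarrow> w k \<in> GV"
  using prim_GV[of "Some (Inl k)"] by (simp add: prim_def)

lemma th_GV: "k \<in> {1..\<kappa>} \<Longrightarrow> th k \<in> GV"
  using prim_GV[of "Some (Inr k)"] by (simp add: prim_def)

lemma cross_prim: "i \<in> prim_idx \<kappa> \<Longrightarrow> j \<in> prim_idx \<kappa> \<Longrightarrow> i \<noteq> j \<Longrightarrow> cross M (prim x1 w th i) (prim x1 w th j) = 0"
  by (rule cross_indep_gaussian[OF prim_assms])

lemma cross_w_x1: "j \<in> {1..\<kappa>} \<Longrightarrow> cross M (w j) x1 = 0"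
  using cross_prim[of "Some (Inl j)" None] by (simp add: prim_def)

lemma cross_th_x1: "j \<in> {1..\<kappa>} \<Longrightarrow> cross M (th j) x1 = 0"
  using cross_prim[of "Some (Inr j)" None] by (simp add: prim_def)

lemma cross_w_w: "j \<in> {1..\<kappa>} \<Longrightarrow> k \<in> {1..\<kappa>} \<Longrightarrow> j \<noteq> k \<Longrightarrow> cross M (w j) (w k) = 0"
  using cross_prim[of "Some (Inl j)" "Some (Inl k)"] by (simp add: prim_def)

lemma cross_th_th: "j \<in> {1..\<kappa>} \<Longrightarrow> k \<in> {1..\<kappa>} \<Longrightarrow> j \<noteq> k \<Longrightarrow> cross M (th j) (th k) = 0"
  using cross_prim[of "Some (Inr j)" "Some (Inr k)"] by (simp add: prim_def)

lemma cross_w_th: "j \<in> {1..\<kappa>} \<Longrightarrow> k \<in> {1..\<kappa>} \<Longrightarrow> cross M (w j) (th k) = 0"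
  using cross_prim[of "Some (Inl j)" "Some (Inr k)"] by (simp add: prim_def)

lemma cross_th_w: "j \<in> {1..\<kappa>} \<Longrightarrow> k \<in> {1..\<kappa>} \<Longrightarrow> cross M (th j) (w k) = 0"
  using cross_prim[of "Some (Inr j)" "Some (Inl k)"] by (simp add: prim_def)

lemma cross_th_self: "k \<in> {1..\<kappa>} \<Longrightarrow> cross M (th k) (th k) = Th k"
  using smom_gaussian[OF prim_assms, of "Some (Inr k)"] by (simp add: prim_def prim_cov_def smom_eq_cross)

lemma xo_GV: "k \<le> \<kappa> \<Longrightarrow> xo A x1 w k \<in> GV"
proof (induction k)
  case (Suc k)
  then show ?case
    by (cases "k = 0") (simp_all add: x1_GV xo_Suc GV_add GV_mult w_GV)
qed (simp add: x1_GV)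

text \<open>The state at time \<open>k\<close> is built from process noise up to index
  \<open>k - 1\<close>, so \<open>k = j\<close> is allowed.\<close>

lemma cross_w_xo: "k \<le> j \<Longrightarrow> j \<in> {1..\<kappa>} \<Longrightarrow> cross M (w j) (xo A x1 w k) = 0"
proof (induction k)
  case (Suc k)
  then show ?case
    by (cases "k = 0") (simp_all add: cross_w_x1 xo_Suc cross_add_right cross_mult_right cross_w_w w_GV GV_mult xo_GV)
qed (simp add: cross_w_x1)

lemma cross_th_xo: "k \<le> \<kappa> \<Longrightarrow> j \<in> {1..\<kappa>} \<Longrightarrow> cross M (th j) (xo A x1 w k) = 0"
proof (induction k)
  case (Suc k)
  then show ?case
    by (cases "k = 0") (simp_all add: cross_th_x1 xo_Suc cross_add_right cross_mult_right cross_th_w w_GV th_GV GV_mult xo_GV)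
qed (simp add: cross_th_x1)

lemma sig_GV: "k \<in> {1..\<kappa>} \<Longrightarrow> sig A x1 w (L, th) k \<in> GV"
  unfolding sig_def fst_conv snd_conv by (intro GV_add GV_sum GV_mult xo_GV th_GV) auto

lemma cross_sig_zero:
  assumes X: "X \<in> GV" and k: "k \<in> {1..\<kappa>}"
    and xo: "\<And>j. j \<in> {1..k} \<Longrightarrow> cross M X (xo A x1 w j) = 0" and th: "cross M X (th k) = 0"
  shows "cross M X (sig A x1 w (L, th) k) = 0"
proof -
  have x: "xo A x1 w j \<in> GV" if "j \<in> {1..k}" for j using that k by (intro xo_GV) auto
  then have Lx: "(\<lambda>\<omega>. L k j *v xo A x1 w j \<omega>) \<in> GV" if "j \<in> {1..k}" for j
    using that by (intro GV_mult)
  have "cross M X (\<lambda>\<omega>. L k j *v xo A x1 w j \<omega>) = 0" if "j \<in> {1..k}" for j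
    using cross_mult_right[OF X x[OF that]] xo[OF that] by simp
  then have "cross M X (\<lambda>\<omega>. \<Sum>j=1..k. L k j *v xo A x1 w j \<omega>) = 0"
    using cross_sum_right[where I = "{1..k}", OF X Lx] by simp
  then show ?thesis
    unfolding sig_def fst_conv snd_conv using cross_add_right[OF X GV_sum[where I = "{1..k}", OF Lx] th_GV[OF k]] th by simp
qed

lemma cross_w_sig: "k \<le> j \<Longrightarrow> k \<in> {1..\<kappa>} \<Longrightarrow> j \<in> {1..\<kappa>} \<Longrightarrow> cross M (w j) (sig A x1 w (L, th) k) = 0"
  by (rule cross_sig_zero) (auto intro!: w_GV cross_w_xo cross_w_th)

lemma cross_th_sig: "k \<noteq> j \<Longrightarrow> k \<in> {1..\<kappa>} \<Longrightarrow> j \<in> {1..\<kappa>} \<Longrightarrow> cross M (th j) (sig A x1 w (L, th) k) = 0"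
  by (rule cross_sig_zero) (auto intro!: th_GV cross_th_xo cross_th_th)

abbreviation obs :: "(nat \<Rightarrow> nat \<Rightarrow> real^'m^'m) \<Rightarrow> nat \<Rightarrow> 'w measure" where
  "obs L k \<equiv> gen_sa M (sig A x1 w (L, th) ` {1..k})"

lemma subalgebra_obs: "k \<le> \<kappa> \<Longrightarrow> subalgebra M (obs L k)"
  by (rule subalgebra_gen_sa) (auto intro!: GV_measurable sig_GV)

lemma cond_exp_obs_eq:
  fixes f g :: "'w \<Rightarrow> real"
  assumes "k \<le> \<kappa>" "f \<in> prim_span" "g \<in> prim_span" "g \<in> borel_measurable (obs L k)"
    and "\<And>j i. j \<in> {1..k} \<Longrightarrow> expectation (\<lambda>\<omega>. (f \<omega> - g \<omega>) * sig A x1 w (L, th) j \<omega> $ i) = 0"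
  shows "AE \<omega> in M. real_cond_exp M (obs L k) f \<omega> = g \<omega>"
  by (rule cond_exp_eq_of_orthogonal) (use assms in \<open>auto intro!: sig_GV\<close>)

lemma vcond_exp_component_square_integrable:
  assumes "k \<le> \<kappa>" "X \<in> GV"
  shows "random_variable borel (\<lambda>\<omega>. vcond_exp M (obs L k) X \<omega> $ i)"
    "integrable M (\<lambda>\<omega>. (vcond_exp M (obs L k) X \<omega> $ i)\<^sup>2)"
  using cond_exp_square_le(1)[OF subalgebra_obs[OF assms(1)], of "\<lambda>\<omega>. X \<omega> $ i"]
    assms(2) G_square_integrable G_measurable
  by (auto simp: vcond_exp_def GV_def)

text \<open>The estimate inherits mean zero from the state, so the centring in \<open>cov\<close>
  has no effect.\<close>

lemma Hk_eq_smom: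
  assumes "k \<le> \<kappa>"
  shows "Hk M A x1 w (L, th) k = smom M (vcond_exp M (obs L k) (xo A x1 w k))"
proof -
  interpret finite_measure_subalgebra M "obs L k"
    using subalgebra_obs[OF assms] by unfold_locales
  have "expectation (real_cond_exp M (obs L k) (\<lambda>\<omega>. xo A x1 w k \<omega> $ i)) = 0" for i
    using xo_GV[OF assms] real_cond_exp_int(2)[OF G_integrable] G_mean by (simp add: GV_def)
  then have "vexp M (vcond_exp M (obs L k) (xo A x1 w k)) = 0"
    by (simp add: vexp_def vcond_exp_def vec_eq_iff)
  then show ?thesis by (simp add: Hk_def cov_def)
qed

text \<open>Reduces Loewner comparisons of estimate covariances to second moments of scalar
  conditional expectations.\<close>

lemma inner_Hk:
  assumes "k \<le> \<kappa>"
  shows "a \<bullet> (Hk M A x1 w (L, th) k *v a)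
    = expectation (\<lambda>\<omega>. (real_cond_exp M (obs L k) (\<lambda>\<omega>. a \<bullet> xo A x1 w k \<omega>) \<omega>)\<^sup>2)"
proof -
  interpret finite_measure_subalgebra M "obs L k"
    using subalgebra_obs[OF assms] by unfold_locales
  let ?x = "xo A x1 w k" let ?V = "vcond_exp M (obs L k) ?x"
  have x: "integrable M (\<lambda>\<omega>. ?x \<omega> $ i)" for i
    using xo_GV[OF assms] G_integrable by (simp add: GV_def)
  have "AE \<omega> in M. real_cond_exp M (obs L k) (\<lambda>\<omega>. \<Sum>i\<in>UNIV. a $ i * ?x \<omega> $ i) \<omega>
      = (\<Sum>i\<in>UNIV. real_cond_exp M (obs L k) (\<lambda>\<omega>. a $ i * ?x \<omega> $ i) \<omega>)"
    using x by (intro real_cond_exp_sum) simp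
  moreover have "AE \<omega> in M. \<forall>i. real_cond_exp M (obs L k) (\<lambda>\<omega>. a $ i * ?x \<omega> $ i) \<omega>
      = a $ i * real_cond_exp M (obs L k) (\<lambda>\<omega>. ?x \<omega> $ i) \<omega>"
    using x real_cond_exp_cmult by (simp add: AE_all_countable)
  ultimately have ae: "AE \<omega> in M. (a \<bullet> ?V \<omega>)\<^sup>2 = (real_cond_exp M (obs L k) (\<lambda>\<omega>. a \<bullet> ?x \<omega>) \<omega>)\<^sup>2"
    by eventually_elim (simp add: inner_vec_def vcond_exp_def)
  have "?V \<in> borel_measurable M"
    unfolding borel_measurable_vec_iff
    using vcond_exp_component_square_integrable(1)[OF assms xo_GV[OF assms]] by blast
  then have "expectation (\<lambda>\<omega>. (a \<bullet> ?V \<omega>)\<^sup>2)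
      = expectation (\<lambda>\<omega>. (real_cond_exp M (obs L k) (\<lambda>\<omega>. a \<bullet> ?x \<omega>) \<omega>)\<^sup>2)"
    using ae by (intro integral_cong_AE) auto
  then show ?thesis
    using inner_matrix_smom(2)[OF vcond_exp_component_square_integrable[OF assms xo_GV[OF assms]]]
    by (simp add: Hk_eq_smom[OF assms])
qed

section \<open>Estimate covariances satisfy the constraints of \<open>Psi\<close>\<close>

lemma symm_Hk: "k \<le> \<kappa> \<Longrightarrow> symm (Hk M A x1 w (L, th) k)"
  by (simp add: Hk_eq_smom symm_smom)

lemma psd_Hk: "k \<le> \<kappa> \<Longrightarrow> psd (Hk M A x1 w (L, th) k)"
  by (simp add: psd_def symm_Hk inner_Hk)

lemma psd_Sigo_minus_Hk:
  assumes "k \<le> \<kappa>"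
  shows "psd (Sigo M A x1 w k - Hk M A x1 w (L, th) k)"
  unfolding psd_def
proof (intro conjI allI)
  show "symm (Sigo M A x1 w k - Hk M A x1 w (L, th) k)"
    using assms by (simp add: symm_diff symm_Hk Sigo_def symm_smom)
  fix a
  have g: "(\<lambda>\<omega>. a \<bullet> xo A x1 w k \<omega>) \<in> prim_span" by (rule GV_inner[OF xo_GV[OF assms]])
  have "a \<bullet> (Sigo M A x1 w k *v a) = expectation (\<lambda>\<omega>. (a \<bullet> xo A x1 w k \<omega>)\<^sup>2)"
    unfolding Sigo_def using xo_GV[OF assms] G_measurable G_square_integrable
    by (intro inner_matrix_smom) (auto simp: GV_def)
  then show "0 \<le> a \<bullet> ((Sigo M A x1 w k - Hk M A x1 w (L, th) k) *v a)"
    using cond_exp_square_le(2)[OF subalgebra_obs[OF assms] G_measurable[OF g] G_square_integrable[OF g], of L]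
    by (simp add: matrix_vector_mult_diff_rdistrib inner_diff_right inner_Hk[OF assms])
qed

text \<open>With \<open>b = A' a\<close>, the estimates of \<open>a \<bullet> x_{k+1}\<close> and
  \<open>b \<bullet> x_k\<close> from the signals up to \<open>k\<close> agree. By the tower
  property this common estimate is a conditional expectation of the one that also uses signal
  \<open>k + 1\<close>, and conditioning lowers second moments.\<close>

lemma psd_Hk_Suc_minus:
  assumes k: "1 \<le> k" "Suc k \<le> \<kappa>"
  shows "psd (Hk M A x1 w (L, th) (Suc k) - A ** Hk M A x1 w (L, th) k ** transpose A)"
  unfolding psd_def
proof (intro conjI allI)
  have k': "k \<le> \<kappa>" using k by simp
  show "symm (Hk M A x1 w (L, th) (Suc k) - A ** Hk M A x1 w (L, th) k ** transpose A)"
    using k by (simp add: symm_diff symm_Hk symm_congruence)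
  fix a
  interpret finite_measure_subalgebra M "obs L k"
    using subalgebra_obs[OF k'] by unfold_locales
  define b where "b = transpose A *v a"
  let ?x = "xo A x1 w"
  define f where "f \<omega> = a \<bullet> ?x (Suc k) \<omega>" for \<omega>
  have f: "f \<in> prim_span" unfolding f_def[abs_def] by (rule GV_inner[OF xo_GV[OF k(2)]])
  have bx: "(\<lambda>\<omega>. b \<bullet> ?x k \<omega>) \<in> prim_span" by (rule GV_inner[OF xo_GV[OF k']])
  have aw: "(\<lambda>\<omega>. a \<bullet> w k \<omega>) \<in> prim_span" using k by (intro GV_inner w_GV) simp
  have "f = (\<lambda>\<omega>. b \<bullet> ?x k \<omega> + a \<bullet> w k \<omega>)"
    using k by (simp add: f_def[abs_def] xo_Suc b_def inner_add_right dot_lmul_matrix)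
  then have 1: "AE \<omega> in M. real_cond_exp M (obs L k) f \<omega> = real_cond_exp M (obs L k) (\<lambda>\<omega>. b \<bullet> ?x k \<omega>) \<omega>
      + real_cond_exp M (obs L k) (\<lambda>\<omega>. a \<bullet> w k \<omega>) \<omega>"
    using real_cond_exp_add[OF G_integrable[OF bx] G_integrable[OF aw]] by simp
  \<comment> \<open>Zero is the projection of \<open>a \<bullet> w k\<close>, because the signals up
    to \<open>k\<close> contain process noise only up to index \<open>k - 1\<close>.\<close>
  have 2: "AE \<omega> in M. real_cond_exp M (obs L k) (\<lambda>\<omega>. a \<bullet> w k \<omega>) \<omega> = 0"
  proof (rule cond_exp_obs_eq[OF k' aw G_zero])
    fix j i assume j: "j \<in> {1..k}"
    have wk: "k \<in> {1..\<kappa>}" "j \<in> {1..\<kappa>}" using k j by auto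
    have "cross M (w k) (sig A x1 w (L, th) j) = 0"
      using wk j by (intro cross_w_sig) auto
    then have "expectation (\<lambda>\<omega>. w k \<omega> $ l * sig A x1 w (L, th) j \<omega> $ i) = 0" for l
      by (rule orthogonal_of_cross_zero)
    moreover have "integrable M (\<lambda>\<omega>. w k \<omega> $ l * sig A x1 w (L, th) j \<omega> $ i)" for l
      by (rule GV_integrable_mult[OF w_GV[OF wk(1)] sig_GV[OF wk(2)]])
    ultimately show "expectation (\<lambda>\<omega>. (a \<bullet> w k \<omega> - 0) * sig A x1 w (L, th) j \<omega> $ i) = 0"
      by (simp add: inner_vec_def sum_distrib_right mult.assoc)
  qed simp
  have 3: "AE \<omega> in M. real_cond_exp M (obs L k) (real_cond_exp M (obs L (Suc k)) f) \<omega> = real_cond_exp M (obs L k) f \<omega>"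
  proof (rule real_cond_exp_nested_subalg)
    show "subalgebra (obs L (Suc k)) (obs L k)"
      by (rule subalgebra_gen_sa_mono) (rule image_mono, simp)
  qed (use subalgebra_obs[OF k(2)] G_integrable[OF f] in auto)
  have "AE \<omega> in M. (real_cond_exp M (obs L k) (\<lambda>\<omega>. b \<bullet> ?x k \<omega>) \<omega>)\<^sup>2
      = (real_cond_exp M (obs L k) (real_cond_exp M (obs L (Suc k)) f) \<omega>)\<^sup>2"
    using 1 2 3 by eventually_elim simp
  then have "expectation (\<lambda>\<omega>. (real_cond_exp M (obs L k) (\<lambda>\<omega>. b \<bullet> ?x k \<omega>) \<omega>)\<^sup>2)
      = expectation (\<lambda>\<omega>. (real_cond_exp M (obs L k) (real_cond_exp M (obs L (Suc k)) f) \<omega>)\<^sup>2)"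
    by (intro integral_cong_AE) auto
  also have "\<dots> \<le> expectation (\<lambda>\<omega>. (real_cond_exp M (obs L (Suc k)) f \<omega>)\<^sup>2)"
    using cond_exp_square_le(1)[OF subalgebra_obs[OF k(2)] G_measurable[OF f] G_square_integrable[OF f]]
    by (intro cond_exp_square_le(2) subalgebra_obs k') auto
  finally show "0 \<le> a \<bullet> ((Hk M A x1 w (L, th) (Suc k) - A ** Hk M A x1 w (L, th) k ** transpose A) *v a)"
    unfolding matrix_vector_mult_diff_rdistrib inner_diff_right inner_congruence b_def[symmetric]
      inner_Hk[OF k'] inner_Hk[OF k(2)] f_def[abs_def] by simp
qed

lemma Hk_in_Psi:
  assumes "1 \<le> \<kappa>"
  shows "Hk M A x1 w (L, th) \<in> Psi \<kappa> A (Sigo M A x1 w)"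
proof -
  have "loewner_ge (Hk M A x1 w (L, th) k) (A ** Hk M A x1 w (L, th) (k - 1) ** transpose A)"
    if "k \<in> {2..\<kappa>}" for k
  proof -
    have "1 \<le> k - 1" "Suc (k - 1) = k" using that by auto
    then show ?thesis using psd_Hk_Suc_minus[of "k - 1" L] that by (simp add: loewner_ge_def)
  qed
  then show ?thesis
    using assms by (auto simp: Psi_def loewner_ge_def psd_Hk psd_Sigo_minus_Hk)
qed

text \<open>\<open>Psi\<close> leaves \<open>S 0\<close> free; replacing it by 0 in
  \<open>S0\<close> lets the first stage follow the general recursion, with innovation covariance
  \<open>Sigo M A x1 w 1\<close> and \<open>D 1 = S 1\<close>.\<close>

context
  fixes S g :: "nat \<Rightarrow> real^'m^'m" and S0 D :: "nat \<Rightarrow> real^'m^'m"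
  defines "S0 \<equiv> \<lambda>k. if k = 0 then 0 else S k"
    and "D \<equiv> \<lambda>k. S k - A ** S0 (k - 1) ** transpose A"
  assumes S_symm: "\<And>k. k \<in> {1..\<kappa>} \<Longrightarrow> symm (S k)"
    and gain: "\<And>k. k \<in> {1..\<kappa>} \<Longrightarrow> g k ** (Sigo M A x1 w k - A ** S0 (k - 1) ** transpose A) = D k"
    and Th_eq: "\<And>k. k \<in> {1..\<kappa>} \<Longrightarrow> Th k = D k - D k ** transpose (g k)"
begin

abbreviation "Lg \<equiv> \<lambda>k j. if j = k then g k else 0"
abbreviation "xh \<equiv> xhat A x1 w th g"
abbreviation "s \<equiv> sig A x1 w (Lg, th)"

lemma sig_Lg: "1 \<le> k \<Longrightarrow> s k = (\<lambda>\<omega>. g k *v xo A x1 w k \<omega> + th k \<omega>)"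
proof -
  assume k: "1 \<le> k"
  have "(\<Sum>j=1..k. (if j = k then g k else 0) *v xo A x1 w j \<omega>) = (\<Sum>j=1..k. if j = k then g k *v xo A x1 w k \<omega> else 0)" for \<omega>
    by (rule sum.cong) auto
  then show ?thesis using k by (simp add: sig_def)
qed

lemma xhat_GV: "k \<le> \<kappa> \<Longrightarrow> xh k \<in> GV"
  by (induction k) (simp_all add: GV_zero GV_add GV_mult GV_diff xo_GV th_GV)

lemma cross_w_xhat: "k \<le> j \<Longrightarrow> j \<in> {1..\<kappa>} \<Longrightarrow> cross M (w j) (xh k) = 0"
  by (induction k) (simp_all add: cross_zero_right cross_add_right cross_diff_right cross_mult_right cross_w_xo cross_w_th
      GV_add GV_mult GV_diff xo_GV th_GV w_GV xhat_GV del: xo.simps)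

text \<open>Strict, because the estimate at time \<open>j\<close> contains
  \<open>th j\<close>.\<close>

lemma cross_th_xhat: "k < j \<Longrightarrow> j \<in> {1..\<kappa>} \<Longrightarrow> cross M (th j) (xh k) = 0"
  by (induction k) (simp_all add: cross_zero_right cross_add_right cross_diff_right cross_mult_right cross_th_xo cross_th_th
      GV_add GV_mult GV_diff xo_GV th_GV xhat_GV del: xo.simps)

lemma cross_zero_swap: "cross M X Y = 0 \<Longrightarrow> cross M Y X = 0"
  using cross_transpose[of M X Y] by (simp add: transpose_def vec_eq_iff)

text \<open>The innovation \<open>e\<close> at time \<open>k + 1\<close> has covariance
  \<open>\<Sigma>\<^sub>k\<^sub>+\<^sub>1 - A S\<^sub>k A'\<close>; the gain \<open>g\<close> and the noise covariance are chosen so that the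
  fresh signal \<open>y\<close> satisfies \<open>E e y' = E y y' = D\<close>, i.e. \<open>y\<close> is its own best estimate of \<open>e\<close>.\<close>
lemma estimation_error_step:
  assumes k: "Suc k \<le> \<kappa>"
    and e_s: "\<And>j. j \<in> {1..k} \<Longrightarrow> cross M (\<lambda>\<omega>. xo A x1 w (Suc k) \<omega> - A *v xh k \<omega>) (s j) = 0"
    and e_xh: "cross M (\<lambda>\<omega>. xo A x1 w (Suc k) \<omega> - A *v xh k \<omega>) (xh k) = 0"
    and xh_xh: "cross M (xh k) (xh k) = S0 k"
  shows "\<And>j. j \<in> {1..Suc k} \<Longrightarrow> cross M (\<lambda>\<omega>. xo A x1 w (Suc k) \<omega> - xh (Suc k) \<omega>) (s j) = 0"
    and "cross M (\<lambda>\<omega>. xo A x1 w (Suc k) \<omega> - xh (Suc k) \<omega>) (xh (Suc k)) = 0"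
    and "cross M (xh (Suc k)) (xh (Suc k)) = S0 (Suc k)"
proof -
  let ?k = "Suc k"
  have kk: "?k \<in> {1..\<kappa>}" "k \<le> \<kappa>" using k by auto
  define e where "e \<omega> = xo A x1 w ?k \<omega> - A *v xh k \<omega>" for \<omega>
  define y where "y \<omega> = g ?k *v e \<omega> + th ?k \<omega>" for \<omega>
  define z where "z \<omega> = A *v xh k \<omega>" for \<omega>
  let ?P = "Sigo M A x1 w ?k - A ** S0 k ** transpose A"
  have GV: "xh k \<in> GV" "e \<in> GV" "y \<in> GV" "z \<in> GV" "th ?k \<in> GV"
    unfolding e_def[abs_def] y_def[abs_def] z_def[abs_def]
    using k kk by (auto intro!: GV_add GV_mult GV_diff xhat_GV xo_GV th_GV)
  have xo_e: "xo A x1 w ?k = (\<lambda>\<omega>. e \<omega> + z \<omega>)" by (simp add: e_def z_def)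
  have xh_y: "xh ?k = (\<lambda>\<omega>. z \<omega> + y \<omega>)" by (simp add: y_def e_def z_def)
  \<comment> \<open>The new estimation error is what remains of the innovation \<open>e\<close>
    after subtracting its estimate \<open>y\<close>.\<close>
  have eps: "(\<lambda>\<omega>. xo A x1 w ?k \<omega> - xh ?k \<omega>) = (\<lambda>\<omega>. e \<omega> - y \<omega>)"
    by (simp only: xo_e xh_y) (simp add: algebra_simps)
  have e_xh': "cross M e (xh k) = 0" using e_xh unfolding e_def[abs_def] .
  have e_z: "cross M e z = 0" unfolding z_def[abs_def] using GV e_xh' by (simp add: cross_mult_right)
  have z_z: "cross M z z = A ** S0 k ** transpose A"
    unfolding z_def[abs_def] using GV by (simp add: cross_mult_right cross_mult_left GV_mult xh_xh matrix_mul_assoc)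
  \<comment> \<open>The state splits orthogonally into innovation and prediction, which identifies
    the covariance of \<open>e\<close>.\<close>
  have "Sigo M A x1 w ?k = cross M e e + cross M z z"
    unfolding Sigo_def smom_eq_cross xo_e
    using GV e_z cross_zero_swap[OF e_z] by (simp add: cross_add_left cross_add_right GV_add)
  then have e_e: "cross M e e = ?P" using z_z by simp
  have th_e: "cross M (th ?k) e = 0"
    unfolding e_def[abs_def] using GV kk k
    by (simp add: cross_diff_right cross_mult_right cross_th_xo cross_th_xhat xo_GV GV_mult del: xo.simps)
  have S0_symm: "symm (S0 k)"
    using S_symm kk by (auto simp: S0_def symm_def transpose_def vec_eq_iff)
  have D_symm: "symm (D ?k)"
    unfolding D_def using S_symm[OF kk(1)] symm_congruence[OF S0_symm, of A] by (simp add: symm_diff)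
  have P_symm: "symm ?P"
    unfolding Sigo_def by (intro symm_diff symm_smom symm_congruence S0_symm)
  have gP: "g ?k ** ?P = D ?k" using gain[OF kk(1)] by simp
  have Pg: "?P ** transpose (g ?k) = D ?k"
    using arg_cong[OF gP, of transpose] P_symm D_symm by (simp add: matrix_transpose_mul symm_def)
  have e_y: "cross M e y = D ?k"
    unfolding y_def[abs_def] using GV e_e Pg cross_zero_swap[OF th_e]
    by (simp add: cross_add_right cross_mult_right GV_mult)
  have "cross M y y = g ?k ** cross M e y + cross M (th ?k) y"
    using GV by (subst (1) y_def[abs_def]) (simp add: cross_add_left cross_mult_left GV_mult)
  also have "cross M (th ?k) y = Th ?k"
    unfolding y_def[abs_def] using GV th_e kk by (simp add: cross_add_right cross_mult_right GV_mult cross_th_self)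
  \<comment> \<open>Both sides equal \<open>g P g'\<close>; adding the noise covariance cancels this
    term and leaves \<open>D\<close>.\<close>
  also have "g ?k ** cross M e y = D ?k ** transpose (g ?k)"
    unfolding e_y by (metis gP Pg matrix_mul_assoc)
  finally have y_y: "cross M y y = D ?k" using Th_eq[OF kk(1)] by simp
  have y_xh: "cross M y (xh k) = 0"
    unfolding y_def[abs_def] using GV e_xh' kk by (simp add: cross_add_left cross_mult_left GV_mult cross_th_xhat)
  have y_z: "cross M y z = 0" unfolding z_def[abs_def] using GV y_xh by (simp add: cross_mult_right)
  have ey_y: "cross M (\<lambda>\<omega>. e \<omega> - y \<omega>) y = 0"
    using GV e_y y_y by (simp add: cross_diff_left)
  have ey_z: "cross M (\<lambda>\<omega>. e \<omega> - y \<omega>) z = 0"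
    using GV e_z y_z by (simp add: cross_diff_left)
  show "cross M (\<lambda>\<omega>. xo A x1 w ?k \<omega> - xh ?k \<omega>) (xh ?k) = 0"
    unfolding eps unfolding xh_y using GV ey_y ey_z by (simp add: cross_add_right GV_diff)
  show "cross M (xh ?k) (xh ?k) = S0 ?k"
    unfolding xh_y using GV z_z y_z cross_zero_swap[OF y_z] y_y
    by (simp add: cross_add_left cross_add_right GV_add D_def S0_def)
  fix j assume j: "j \<in> {1..?k}"
  show "cross M (\<lambda>\<omega>. xo A x1 w ?k \<omega> - xh ?k \<omega>) (s j) = 0"
  proof (cases "j = ?k")
    case True
    \<comment> \<open>Compared with \<open>y\<close>, the signal carries the extra term
      \<open>g z\<close>, to which the error is orthogonal as well.\<close>
    have "s ?k = (\<lambda>\<omega>. y \<omega> + g ?k *v z \<omega>)"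
      by (simp only: sig_Lg xo_e y_def matrix_vector_right_distrib) (simp add: algebra_simps)
    then show ?thesis
      unfolding eps True using GV ey_y ey_z by (simp add: cross_add_right cross_mult_right GV_diff GV_mult)
  next
    case False
    then have j': "j \<in> {1..k}" "j \<in> {1..\<kappa>}" "j \<noteq> ?k" using j k by auto
    have sj: "s j \<in> GV" using j' by (intro sig_GV)
    have "cross M e (s j) = 0" using e_s[OF j'(1)] unfolding e_def[abs_def] .
    then have "cross M y (s j) = 0"
      unfolding y_def[abs_def] using GV sj cross_th_sig[OF j'(3,2) kk(1)]
      by (simp add: cross_add_left cross_mult_left GV_mult)
    then show ?thesis
      unfolding eps using \<open>cross M e (s j) = 0\<close> GV sj by (simp add: cross_diff_left)
  qed
qed

text \<open>Orthogonality to \<open>xh k\<close> separates the next innovation from the prediction,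
  and the covariance of \<open>xh k\<close> fixes that of the innovation; hence both are carried
  through the induction together with the orthogonality to the signals.\<close>

lemma estimation_error_orthogonal:
  assumes "1 \<le> k" "k \<le> \<kappa>"
  shows "(\<forall>j\<in>{1..k}. cross M (\<lambda>\<omega>. xo A x1 w k \<omega> - xh k \<omega>) (s j) = 0)
    \<and> cross M (\<lambda>\<omega>. xo A x1 w k \<omega> - xh k \<omega>) (xh k) = 0 \<and> cross M (xh k) (xh k) = S0 k"
  using assms
proof (induction k rule: dec_induct)
  case base
  \<comment> \<open>At time 0 there are no signals and the estimate is 0, so the invariants are
    trivial and time 1 follows by the same step as later times.\<close>
  have z: "cross M X (xh 0) = 0" for X by (simp add: cross_zero_right)
  have "cross M (xh 0) (xh 0) = S0 0" by (simp only: z) (simp add: S0_def)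
  from estimation_error_step[of 0, OF _ _ z this] base show ?case by simp
next
  case (step k)
  let ?eps = "\<lambda>\<omega>. xo A x1 w k \<omega> - xh k \<omega>"
  have k: "k \<in> {1..\<kappa>}" "k \<le> \<kappa>" using step by auto
  have eps: "?eps \<in> GV" using k by (intro GV_diff xo_GV xhat_GV)
  \<comment> \<open>The prediction error is the propagated estimation error plus fresh process
    noise, which is orthogonal to all signals so far.\<close>
  have e: "(\<lambda>\<omega>. xo A x1 w (Suc k) \<omega> - A *v xh k \<omega>) = (\<lambda>\<omega>. A *v ?eps \<omega> + w k \<omega>)"
    using step by (simp add: xo_Suc matrix_vector_mult_diff_distrib fun_eq_iff)
  have IH: "cross M ?eps (xh k) = 0" "cross M (xh k) (xh k) = S0 k"
    and IHs: "\<And>j. j \<in> {1..k} \<Longrightarrow> cross M ?eps (s j) = 0"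
    using step.IH k by auto
  have "cross M (\<lambda>\<omega>. A *v ?eps \<omega> + w k \<omega>) (s j) = 0" if "j \<in> {1..k}" for j
  proof -
    have j: "j \<le> k" "j \<in> {1..\<kappa>}" using that k by auto
    show ?thesis
      using cross_add_left[OF GV_mult[OF eps] w_GV[OF k(1)] sig_GV[OF j(2)]] cross_mult_left[OF eps sig_GV[OF j(2)]]
        IHs[OF that] cross_w_sig[OF j k(1)] by simp
  qed
  moreover have "cross M (\<lambda>\<omega>. A *v ?eps \<omega> + w k \<omega>) (xh k) = 0"
    using cross_add_left[OF GV_mult[OF eps] w_GV[OF k(1)] xhat_GV[OF k(2)]] cross_mult_left[OF eps xhat_GV[OF k(2)]]
      IH(1) cross_w_xhat[OF order_refl k(1)] by simp
  ultimately show ?case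
    using estimation_error_step[of k] IH(2) step.prems unfolding e by blast
qed

lemma xhat_measurable_obs: "xh k \<in> borel_measurable (obs Lg k)"
proof (induction k)
  case (Suc k)
  have "subalgebra (obs Lg (Suc k)) (obs Lg k)"
    by (rule subalgebra_gen_sa_mono) (rule image_mono, simp)
  from measurable_from_subalg[OF this Suc] have xh: "xh k \<in> borel_measurable (obs Lg (Suc k))" .
  have "s (Suc k) \<in> borel_measurable (obs Lg (Suc k))"
    by (rule measurable_gen_sa) simp
  \<comment> \<open>Rewritten through the signal, the update no longer mentions the unobserved state
    or noise.\<close>
  moreover have "xh (Suc k) = (\<lambda>\<omega>. A *v xh k \<omega> + s (Suc k) \<omega> - g (Suc k) *v (A *v xh k \<omega>))"
    by (simp add: sig_Lg matrix_vector_mult_diff_distrib fun_eq_iff del: xo.simps)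
  ultimately show ?case
    by (simp only:) (intro borel_measurable_diff borel_measurable_add measurable_matrix_vector_mult xh)
qed simp

text \<open>\<open>xh k\<close> is a function of the signals whose error is orthogonal to them,
  hence a version of the conditional expectation; its second moment is already known.\<close>

lemma Hk_linear_rule:
  assumes k: "k \<in> {1..\<kappa>}"
  shows "Hk M A x1 w (Lg, th) k = S k"
proof -
  let ?V = "vcond_exp M (obs Lg k) (xo A x1 w k)"
  have k': "1 \<le> k" "k \<le> \<kappa>" using k by auto
  have orth: "cross M (\<lambda>\<omega>. xo A x1 w k \<omega> - xh k \<omega>) (s j) = 0" if "j \<in> {1..k}" for j
    using estimation_error_orthogonal[OF k'] that by blast
  have comp: "AE \<omega> in M. ?V \<omega> $ i = xh k \<omega> $ i" for i
    unfolding vcond_exp_def vec_lambda_beta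
  proof (rule cond_exp_obs_eq[OF k'(2)])
    show "(\<lambda>\<omega>. xo A x1 w k \<omega> $ i) \<in> prim_span" "(\<lambda>\<omega>. xh k \<omega> $ i) \<in> prim_span"
      using xo_GV[OF k'(2)] xhat_GV[OF k'(2)] by (simp_all add: GV_def)
    show "(\<lambda>\<omega>. xh k \<omega> $ i) \<in> borel_measurable (obs Lg k)"
      using xhat_measurable_obs[of k] unfolding borel_measurable_vec_iff by blast
    show "expectation (\<lambda>\<omega>. (xo A x1 w k \<omega> $ i - xh k \<omega> $ i) * s j \<omega> $ l) = 0" if "j \<in> {1..k}" for j l
      using orthogonal_of_cross_zero[OF orth[OF that], of i l] by simp
  qed
  have "smom M ?V = smom M (xh k)"
  proof -
    have "expectation (\<lambda>\<omega>. ?V \<omega> $ i * ?V \<omega> $ j) = expectation (\<lambda>\<omega>. xh k \<omega> $ i * xh k \<omega> $ j)" for i j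
    proof (rule integral_cong_AE)
      show "AE \<omega> in M. ?V \<omega> $ i * ?V \<omega> $ j = xh k \<omega> $ i * xh k \<omega> $ j"
        using comp[of i] comp[of j] by eventually_elim simp
      show "(\<lambda>\<omega>. ?V \<omega> $ i * ?V \<omega> $ j) \<in> borel_measurable M"
        by (intro borel_measurable_times vcond_exp_component_square_integrable(1) xo_GV k')
      show "(\<lambda>\<omega>. xh k \<omega> $ i * xh k \<omega> $ j) \<in> borel_measurable M"
        using GV_integrable_mult[OF xhat_GV[OF k'(2)] xhat_GV[OF k'(2)]] by auto
    qed
    then show ?thesis by (simp add: smom_def)
  qed
  then show ?thesis
    using estimation_error_orthogonal[OF k'] k' by (simp add: Hk_eq_smom smom_eq_cross S0_def)
qed

end

end

lemma game_obj_cong: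
  "(\<And>k. k \<in> {1..\<kappa>} \<Longrightarrow> S k = T k) \<Longrightarrow> game_obj W \<kappa> xi Xi S = game_obj W \<kappa> xi Xi T"
  by (simp add: game_obj_def)

theorem theorem1:
  fixes M :: "'w measure" and \<kappa> :: nat
    and A Sig1 Sigw :: "real^'m::finite^'m"
    and x1 :: "'w \<Rightarrow> real^'m" and w :: "nat \<Rightarrow> 'w \<Rightarrow> real^'m"
    and \<Omega> :: "'a set" and \<omega>o :: 'a
    and Xi :: "nat \<Rightarrow> 'a \<Rightarrow> real^'m^'m" and xi :: "'a \<Rightarrow> real"
    and U :: "(nat \<Rightarrow> nat \<Rightarrow> real^'m^'m) \<times> (nat \<Rightarrow> 'w \<Rightarrow> real^'m) \<Rightarrow> real"
  assumes P: "prob_space M"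
    and kappa: "1 \<le> \<kappa>"
    and Sig1: "psd Sig1" and Sigw: "psd Sigw"
    and x1: "gaussian_vec M x1 Sig1"
    and w: "\<forall>k\<in>{1..\<kappa>}. gaussian_vec M (w k) Sigw"
    and indep: "prob_space.indep_vars M (\<lambda>_. borel) (prim x1 w (\<lambda>_ _. 0)) ({None} \<union> Some ` Inl ` {1..\<kappa>})"
    and rich: "\<forall>Th. (\<forall>k\<in>{1..\<kappa>}. psd (Th k)) \<longrightarrow> (\<exists>th. noise_ok M \<kappa> x1 w th Th)"
    and fin: "finite \<Omega>" and wo: "\<omega>o \<notin> \<Omega>"
    and Xi_sym: "\<forall>\<omega>\<in>insert \<omega>o \<Omega>. \<forall>k\<in>{1..\<kappa>}. symm (Xi k \<omega>)"
    and US: "\<forall>eta\<in>Upsilon M \<kappa> x1 w.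
       U eta = (SUP p\<in>prob_simplex (insert \<omega>o \<Omega>). \<Sum>\<omega>\<in>insert \<omega>o \<Omega>.
                  p \<omega> * (xi \<omega> + (\<Sum>k=1..\<kappa>. trace (Hk M A x1 w eta k ** Xi k \<omega>))))"
  shows "(\<exists>S\<in>Psi \<kappa> A (Sigo M A x1 w).
            ereal (game_obj (insert \<omega>o \<Omega>) \<kappa> xi Xi S)
              = Min (mu_w (insert \<omega>o \<Omega>) \<kappa> A (Sigo M A x1 w) xi Xi ` insert \<omega>o \<Omega>)
          \<and> (\<forall>S'\<in>Psi \<kappa> A (Sigo M A x1 w).
               game_obj (insert \<omega>o \<Omega>) \<kappa> xi Xi S \<le> game_obj (insert \<omega>o \<Omega>) \<kappa> xi Xi S'))
       \<and> (\<forall>\<omega>s Ss. \<omega>s \<in> insert \<omega>o \<Omega>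
            \<longrightarrow> mu_w (insert \<omega>o \<Omega>) \<kappa> A (Sigo M A x1 w) xi Xi \<omega>s
                  = Min (mu_w (insert \<omega>o \<Omega>) \<kappa> A (Sigo M A x1 w) xi Xi ` insert \<omega>o \<Omega>)
            \<longrightarrow> Ss \<in> Psi \<kappa> A (Sigo M A x1 w)
            \<longrightarrow> (\<forall>\<omega>'\<in>insert \<omega>o \<Omega>.
                  (\<Sum>k=1..\<kappa>. trace (Ss k ** (Xi k \<omega>s - Xi k \<omega>'))) \<ge> xi \<omega>' - xi \<omega>s)
            \<longrightarrow> ereal (xi \<omega>s + (\<Sum>k=1..\<kappa>. trace (Xi k \<omega>s ** Ss k)))
                  = mu_w (insert \<omega>o \<Omega>) \<kappa> A (Sigo M A x1 w) xi Xi \<omega>s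
            \<longrightarrow> (\<exists>eta\<in>Upsilon M \<kappa> x1 w.
                  (\<forall>k\<in>{1..\<kappa>}. Hk M A x1 w eta k = Ss k)
                  \<and> (\<forall>eta'\<in>Upsilon M \<kappa> x1 w. U eta \<le> U eta')))"
proof -
  interpret prob_space M by (rule P)
  let ?W = "insert \<omega>o \<Omega>" and ?So = "Sigo M A x1 w"
  have W: "finite ?W" "?W \<noteq> {}" using fin by auto
  have model: "lqg_model M \<kappa> Sig1 Sigw x1 w th Th" if "noise_ok M \<kappa> x1 w th Th" for th Th
    using that Sig1 Sigw x1 w P by (simp add: lqg_model_def lqg_model_axioms_def)
  have Hk_Psi: "Hk M A x1 w eta \<in> Psi \<kappa> A ?So" if U: "eta \<in> Upsilon M \<kappa> x1 w" for eta
  proof -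
    obtain L th Th where eta: "eta = (L, th)" and n: "noise_ok M \<kappa> x1 w th Th"
      using U by (auto simp: Upsilon_def)
    show ?thesis unfolding eta by (rule lqg_model.Hk_in_Psi[OF model[OF n] kappa])
  qed
  have U_eq: "U eta = game_obj ?W \<kappa> xi Xi (Hk M A x1 w eta)" if "eta \<in> Upsilon M \<kappa> x1 w" for eta
    using US that by (simp add: game_obj_def)
  \<comment> \<open>The silent rule, with zero coefficients and zero noise covariance, witnesses
    that \<open>Psi\<close> is not empty.\<close>
  obtain th0 where "noise_ok M \<kappa> x1 w th0 (\<lambda>_. 0)"
    using rich[rule_format, of "\<lambda>_. 0"] psd_zero by blast
  then have "((\<lambda>_ _. 0), th0) \<in> Upsilon M \<kappa> x1 w" by (auto simp: Upsilon_def)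
  then have ne: "Psi \<kappa> A ?So \<noteq> {}" using Hk_Psi by blast
  show ?thesis (is "?value \<and> ?rule")
  proof
    obtain S where S: "S \<in> Psi \<kappa> A ?So"
      "ereal (game_obj ?W \<kappa> xi Xi S) = Min (mu_w ?W \<kappa> A ?So xi Xi ` ?W)"
      using game_obj_attains_Min_mu_w[OF W ne] by blast
    moreover have "game_obj ?W \<kappa> xi Xi S \<le> game_obj ?W \<kappa> xi Xi S'" if "S' \<in> Psi \<kappa> A ?So" for S'
      using Min_mu_w_le_game_obj[OF W that, of xi Xi] unfolding S(2)[symmetric] by simp
    ultimately show ?value by blast
  next
    show ?rule
    proof (intro allI impI)
      fix \<omega>s Ss
      assume ws: "\<omega>s \<in> ?W" and mu: "mu_w ?W \<kappa> A ?So xi Xi \<omega>s = Min (mu_w ?W \<kappa> A ?So xi Xi ` ?W)"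
        and Ss: "Ss \<in> Psi \<kappa> A ?So"
        and feas: "\<forall>\<omega>'\<in>?W. (\<Sum>k=1..\<kappa>. trace (Ss k ** (Xi k \<omega>s - Xi k \<omega>'))) \<ge> xi \<omega>' - xi \<omega>s"
        and opt: "ereal (xi \<omega>s + (\<Sum>k=1..\<kappa>. trace (Xi k \<omega>s ** Ss k))) = mu_w ?W \<kappa> A ?So xi Xi \<omega>s"
      \<comment> \<open>Feasibility says that \<open>\<omega>s\<close> is a worst type at
        \<open>Ss\<close>, so the game value there is the objective of its problem.\<close>
      have "game_obj ?W \<kappa> xi Xi Ss = type_cost \<kappa> xi Xi Ss \<omega>s"
        using feas unfolding type_cost_constraint_iff by (intro game_obj_eq_type_cost[OF W(1) ws]) blast
      also have "\<dots> = xi \<omega>s + (\<Sum>k=1..\<kappa>. trace (Xi k \<omega>s ** Ss k))"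
        by (simp only: type_cost_def trace_mul_sym[of "Xi _ _"])
      finally have game_value: "ereal (game_obj ?W \<kappa> xi Xi Ss) = Min (mu_w ?W \<kappa> A ?So xi Xi ` ?W)"
        using opt mu by simp
      define S0 where "S0 k = (if k = 0 then 0 else Ss k)" for k
      define D where "D k = Ss k - A ** S0 (k - 1) ** transpose A" for k
      have "\<exists>G. G ** (?So k - A ** S0 (k - 1) ** transpose A) = D k \<and> psd (D k - D k ** transpose G)"
        if k: "k \<in> {1..\<kappa>}" for k
      proof (rule gain_matrix_exists)
        show "psd (D k)"
          using Ss k by (cases "k = 1") (auto simp: D_def S0_def Psi_def loewner_ge_def)
        show "psd (?So k - A ** S0 (k - 1) ** transpose A - D k)"
          using Ss k by (cases "k = 1") (auto simp: D_def Psi_def loewner_ge_def)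
      qed
      then obtain g where g: "\<And>k. k \<in> {1..\<kappa>} \<Longrightarrow> g k ** (?So k - A ** S0 (k - 1) ** transpose A) = D k"
        "\<And>k. k \<in> {1..\<kappa>} \<Longrightarrow> psd (D k - D k ** transpose (g k))"
        by metis
      obtain th where th: "noise_ok M \<kappa> x1 w th (\<lambda>k. D k - D k ** transpose (g k))"
        using rich[rule_format, of "\<lambda>k. D k - D k ** transpose (g k)"] g(2) by blast
      define eta where "eta = ((\<lambda>k j. if j = k then g k else 0), th)"
      have eta: "eta \<in> Upsilon M \<kappa> x1 w" using th by (auto simp: Upsilon_def eta_def)
      have Hk_eta: "Hk M A x1 w eta k = Ss k" if k: "k \<in> {1..\<kappa>}" for k
        unfolding eta_def
      proof (rule lqg_model.Hk_linear_rule[OF model[OF th] _ _ _ k], goal_cases)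
        case (1 k)
        then show ?case using Ss by (simp add: Psi_def psd_def)
      next
        case (2 k)
        from g(1)[OF this] show ?case by (simp only: D_def S0_def)
      next
        case (3 k)
        show ?case by (simp only: D_def S0_def)
      qed
      moreover have "U eta \<le> U eta'" if "eta' \<in> Upsilon M \<kappa> x1 w" for eta'
      proof -
        have "U eta = game_obj ?W \<kappa> xi Xi Ss"
          unfolding U_eq[OF eta] by (rule game_obj_cong) (rule Hk_eta)
        \<comment> \<open>Every competing rule also yields a tuple in \<open>Psi\<close>, so its
          cost cannot fall below the minimum attained at \<open>Ss\<close>.\<close>
        moreover have "ereal (game_obj ?W \<kappa> xi Xi Ss) \<le> ereal (U eta')"
          unfolding game_value U_eq[OF that] by (rule Min_mu_w_le_game_obj[OF W Hk_Psi[OF that]])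
        ultimately show ?thesis by simp
      qed
      ultimately show "\<exists>eta\<in>Upsilon M \<kappa> x1 w. (\<forall>k\<in>{1..\<kappa>}. Hk M A x1 w eta k = Ss k)
          \<and> (\<forall>eta'\<in>Upsilon M \<kappa> x1 w. U eta \<le> U eta')"
        using eta by blast
    qed
  qed
qed

end
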